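(* Let $m,c,\tau>0$ be constants, let $\sigma>-1$, and let the state density be $\phi(\mathcal I)=\mathcal I^{\sigma}$ for $\mathcal I\in(0,\infty)$. Let $f=f(p,\mathcal I)$ be a non-negative measurable function on $\mathbb R^3\times(0,\infty)$ (the distribution function at a fixed space-time point $(t,x)$) which is not trivially zero (i.e. not zero almost everywhere) and such that the particle-particle flux $$V_f^\mu=mc\int_{\mathbb R^3}\int_0^\infty p^\mu f\,\phi(\mathcal I)\,d\mathcal I\,\frac{dp}{p^0},\qquad \mu=0,1,2,3,$$ exists (the integrals converge absolutely). Then there exists a unique set of equilibrium parameters $n>0$, $U^\mu=(\sqrt{c^2+|U|^2},U)$ with $U\in\mathbb R^3$, and $\gamma\in(0,\infty)$ of the Jüttner distribution $f_E=f_E(n,U^\mu,\gamma)$ such that the collision operator $$Q(f)=\frac{cm}{\tau\left(1+\frac{\mathcal I}{mc^2}\right)p^0}\,(f_E-f)$$ satisfies $$\int_{\mathbb R^3}\int_0^\infty Q(f)\,\phi(\mathcal I)\,d\mathcal I\,dp=0,\qquad \int_{\mathbb R^3}\int_0^\infty p^\mu\,(mc^2+\mathcal I)\,Q(f)\,\phi(\mathcal I)\,d\mathcal I\,dp=0\quad(\mu=0,1,2,3).$$ Indeed, $n=n_f$, $U^\mu=U_f^\mu$, and $\gamma$ is determined by the nonlinear relation $$\frac{\widetilde M(\gamma)}{M(\gamma)}=\frac{1}{n_f}\int_{\mathbb R^3}\int_0^\infty f\left(1+\frac{\mathcal I}{mc^2}\right)^{-1}\phi(\mathcal I)\,d\mathcal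 I\,\frac{dp}{p^0},$$ where $$\widetilde M(\gamma)=\int_{\mathbb R^3}\int_0^\infty e^{-\left(1+\frac{\mathcal I}{mc^2}\right)\frac{\gamma}{mc}p^0}\left(1+\frac{\mathcal I}{mc^2}\right)^{-1}\phi(\mathcal I)\,d\mathcal I\,\frac{dp}{p^0}.$$
   Context: Notation. $c$ is the speed of light, $m$ the rest mass of a particle, $\tau$ the relaxation time. The variables are the momentum $p=(p^1,p^2,p^3)\in\mathbb R^3$ and the internal energy $\mathcal I\ge 0$. The four-momentum is $p^\mu=(p^0,p)$ with $p^0=\sqrt{(mc)^2+|p|^2}$. Greek indices run from $0$ to $3$; the metric is $g_{\alpha\beta}=\mathrm{diag}(1,-1,-1,-1)$, so that $p_\mu=(p^0,-p)$ and, with the Einstein summation convention, $U^\mu p_\mu=U^0p^0-\sum_{i=1}^3U^ip^i$. Jüttner distribution for polyatomic gases. For $n>0$, $U^\mu=(\sqrt{c^2+|U|^2},U)$ with $U\in\mathbb R^3$, and $\gamma>0$, $$f_E(n,U^\mu,\gamma)(p,\mathcal I)=\frac{n}{M(\gamma)}\,e^{-\left(1+\frac{\mathcal I}{mc^2}\right)\frac{\gamma}{mc^2}U^\mu p_\mu},\qquad M(\gamma)=\int_{\mathbb R^3}\int_0^\infty e^{-\left(1+\frac{\mathcal I}{mc^2}\right)\frac{\gamma}{mc}p^0}\phi(\mathcal I)\,d\mathcal I\,dp.$$ The parameters $n$, $U^\mu$, $\gamma$ may depend on $(t,x)$ but not on $(p,\mathcal I)$. Eckart quantities of $f$. The number $n_f>0$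 and the four-velocity $U_f^\mu=(\sqrt{c^2+|U_f|^2},U_f)$ are defined by $$n_f^2=\left(\int_{\mathbb R^3}\int_0^\infty f\,\phi(\mathcal I)\,d\mathcal I\,dp\right)^2-\sum_{i=1}^3\left(\int_{\mathbb R^3}\int_0^\infty p^i f\,\phi(\mathcal I)\,d\mathcal I\,\frac{dp}{p^0}\right)^2,\qquad U_f^\mu=\frac{c}{n_f}\int_{\mathbb R^3}\int_0^\infty p^\mu f\,\phi(\mathcal I)\,d\mathcal I\,\frac{dp}{p^0},$$ where $n_f$ is the positive square root. *)

theory Defs
  imports "HOL-Analysis.Analysis"
begin

text \<open>
  A four-vector is a pair of its time component (index 0) and its spatial part (indices 1, 2, 3).
  An identity holding for every index 0, 1, 2, 3 is written as one identity of four-vectors, and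
  four-vector valued integrals are Bochner integrals, that is, they are taken componentwise.
\<close>

type_synonym four_vector = "real \<times> (real ^ 3)"

definition lorentz_product :: "four_vector \<Rightarrow> four_vector \<Rightarrow> real" where
  "lorentz_product X Y = fst X * fst Y - (\<Sum>i\<in>UNIV. snd X $ i * snd Y $ i)"

definition energy0 :: "real \<Rightarrow> real \<Rightarrow> real ^ 3 \<Rightarrow> real" where
  "energy0 m c p = sqrt ((m * c)\<^sup>2 + (norm p)\<^sup>2)"

definition four_momentum :: "real \<Rightarrow> real \<Rightarrow> real ^ 3 \<Rightarrow> four_vector" where
  "four_momentum m c p = (energy0 m c p, p)"

definition four_velocity :: "real \<Rightarrow> real ^ 3 \<Rightarrow> four_vector" where
  "four_velocity c U = (sqrt (c\<^sup>2 + (norm U)\<^sup>2), U)"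

text \<open>
  The double integrals over momenta and internal energies are integrals with respect to the
  Lebesgue measure on the product of the momentum space with the open half-line. All of them
  converge absolutely, so that they agree with the iterated integrals.
\<close>

definition phase_measure :: "((real ^ 3) \<times> real) measure" where
  "phase_measure = lebesgue_on (UNIV \<times> {0<..})"

definition state_density :: "real \<Rightarrow> real \<Rightarrow> real" where
  "state_density \<sigma> I = I powr \<sigma>"

definition juttner_M :: "real \<Rightarrow> real \<Rightarrow> real \<Rightarrow> real \<Rightarrow> real" where
  "juttner_M m c \<sigma> \<gamma> =
     integral\<^sup>L phase_measure (\<lambda>(p, I).
       exp (- ((1 + I / (m * c\<^sup>2)) * (\<gamma> / (m * c)) * energy0 m c p)) * state_density \<sigma> I)"

definition juttner_M_tilde :: "real \<Rightarrow> real \<Rightarrow> real \<Rightarrow> real \<Rightarrow> real" where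
  "juttner_M_tilde m c \<sigma> \<gamma> =
     integral\<^sup>L phase_measure (\<lambda>(p, I).
       exp (- ((1 + I / (m * c\<^sup>2)) * (\<gamma> / (m * c)) * energy0 m c p))
         * inverse (1 + I / (m * c\<^sup>2)) * state_density \<sigma> I / energy0 m c p)"

definition juttner ::
  "real \<Rightarrow> real \<Rightarrow> real \<Rightarrow> real \<Rightarrow> four_vector \<Rightarrow> real \<Rightarrow> (real ^ 3) \<times> real \<Rightarrow> real" where
  "juttner m c \<sigma> n U \<gamma> = (\<lambda>(p, I).
     n / juttner_M m c \<sigma> \<gamma>
       * exp (- ((1 + I / (m * c\<^sup>2)) * (\<gamma> / (m * c\<^sup>2)) * lorentz_product U (four_momentum m c p))))"

text \<open>The integrand of the particle-particle flux, without the constant factor \<open>m * c\<close>.\<close>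

definition flux_density ::
  "real \<Rightarrow> real \<Rightarrow> real \<Rightarrow> ((real ^ 3) \<times> real \<Rightarrow> real) \<Rightarrow> (real ^ 3) \<times> real \<Rightarrow> four_vector" where
  "flux_density m c \<sigma> f = (\<lambda>(p, I).
     (f (p, I) * state_density \<sigma> I / energy0 m c p) *\<^sub>R four_momentum m c p)"

definition eckart_n :: "real \<Rightarrow> real \<Rightarrow> real \<Rightarrow> ((real ^ 3) \<times> real \<Rightarrow> real) \<Rightarrow> real" where
  "eckart_n m c \<sigma> f =
     sqrt ((integral\<^sup>L phase_measure (\<lambda>(p, I). f (p, I) * state_density \<sigma> I))\<^sup>2
       - (\<Sum>i\<in>UNIV. (integral\<^sup>L phase_measure
            (\<lambda>(p, I). p $ i * f (p, I) * state_density \<sigma> I / energy0 m c p))\<^sup>2))"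

definition eckart_U :: "real \<Rightarrow> real \<Rightarrow> real \<Rightarrow> ((real ^ 3) \<times> real \<Rightarrow> real) \<Rightarrow> four_vector" where
  "eckart_U m c \<sigma> f =
     (c / eckart_n m c \<sigma> f) *\<^sub>R integral\<^sup>L phase_measure (flux_density m c \<sigma> f)"

definition collision_op ::
  "real \<Rightarrow> real \<Rightarrow> real \<Rightarrow> ((real ^ 3) \<times> real \<Rightarrow> real) \<Rightarrow> ((real ^ 3) \<times> real \<Rightarrow> real)
     \<Rightarrow> (real ^ 3) \<times> real \<Rightarrow> real" where
  "collision_op m c \<tau> fE f = (\<lambda>(p, I).
     c * m / (\<tau> * (1 + I / (m * c\<^sup>2)) * energy0 m c p) * (fE (p, I) - f (p, I)))"

text \<open>
  The conservation laws for a collision term \<open>Q\<close>; \<open>has_bochner_integral\<close> says that the integral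
  converges absolutely and has the given value.
\<close>

definition conservation_laws ::
  "real \<Rightarrow> real \<Rightarrow> real \<Rightarrow> ((real ^ 3) \<times> real \<Rightarrow> real) \<Rightarrow> bool" where
  "conservation_laws m c \<sigma> Q \<longleftrightarrow>
     has_bochner_integral phase_measure (\<lambda>(p, I). Q (p, I) * state_density \<sigma> I) 0 \<and>
     has_bochner_integral phase_measure (\<lambda>(p, I).
       ((m * c\<^sup>2 + I) * Q (p, I) * state_density \<sigma> I) *\<^sub>R four_momentum m c p) 0"

definition equilibrium_parameters ::
  "real \<Rightarrow> real \<Rightarrow> real \<Rightarrow> real \<Rightarrow> ((real ^ 3) \<times> real \<Rightarrow> real) \<Rightarrow> real \<Rightarrow> real ^ 3 \<Rightarrow> real \<Rightarrow> bool" where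
  "equilibrium_parameters m c \<tau> \<sigma> f n U \<gamma> \<longleftrightarrow>
     n > 0 \<and> \<gamma> > 0 \<and>
     conservation_laws m c \<sigma> (collision_op m c \<tau> (juttner m c \<sigma> n (four_velocity c U) \<gamma>) f)"

definition gamma_relation ::
  "real \<Rightarrow> real \<Rightarrow> real \<Rightarrow> ((real ^ 3) \<times> real \<Rightarrow> real) \<Rightarrow> real \<Rightarrow> bool" where
  "gamma_relation m c \<sigma> f \<gamma> \<longleftrightarrow>
     juttner_M_tilde m c \<sigma> \<gamma> / juttner_M m c \<sigma> \<gamma> =
       1 / eckart_n m c \<sigma> f * integral\<^sup>L phase_measure (\<lambda>(p, I).
         f (p, I) * inverse (1 + I / (m * c\<^sup>2)) * state_density \<sigma> I / energy0 m c p)"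

end

theory Submission
  imports Defs
begin

text \<open>
  Multiplied by \<open>m c\<^sup>2 + I\<close>, the relaxation rate loses its dependence on the internal energy. Hence the conservation laws
  require two things of the Juettner distribution: it has the same particle flux as \<open>f\<close>, and the same moment of
  \<open>1 / ((1 + I / (m c\<^sup>2)) p\<^sup>0)\<close>.

  The moments of the Juettner distribution are computed in its rest frame. The boost to this frame has the
  Jacobian \<open>p'\<^sup>0 / p\<^sup>0\<close>, so it preserves the measure \<open>dp / p\<^sup>0\<close> (\<open>distr_boost_mass_shell_measure\<close>), and it turns the exponent
  into a multiple of the energy. At rest the spatial flux vanishes by symmetry, and \<open>juttner_M\<close> normalizes the density. Thus the flux is
  \<open>n / c\<close> times the four-velocity, and the scalar moment is \<open>n * juttner_M_tilde / juttner_M\<close>. On the other side, the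
  flux of \<open>f\<close> is timelike, so it determines \<open>n\<close> and \<open>U\<close>, and these are the Eckart quantities (\<open>flux_eq_iff\<close>).

  What remains is one equation for \<open>\<gamma>\<close>. Put \<open>X = (1 + I / (m c\<^sup>2)) p\<^sup>0\<close> and \<open>k = \<gamma> / (m c)\<close>. Then
  \<open>juttner_M_tilde / juttner_M\<close> is the mean of \<open>1 / X\<close> for the weight \<open>exp (- k * X)\<close>. It increases strictly and
  continuously in \<open>k\<close>; it tends to \<open>0\<close> as \<open>k\<close> tends to \<open>0\<close>, because the phase space has infinite measure, and to
  \<open>1 / (m c)\<close> as \<open>k\<close> tends to infinity, because \<open>m c\<close> is the essential infimum of \<open>X\<close> (\<open>ratio_unique_root\<close>). The prescribed
  value is positive and lies below \<open>1 / (m c)\<close>, because against the weight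
  \<open>f \<phi> / p\<^sup>0\<close> the comoving energy, which is at least \<open>m c\<close>, integrates to \<open>n\<^sub>f\<close>, whereas the moment of \<open>f\<close>
  integrates \<open>1 / (1 + I / (m c\<^sup>2)) < 1\<close> (\<open>inverse_energy_moment_bounds\<close>).
\<close>

section \<open>Mean inverse energy of a family of Gibbs weights\<close>

lemma integral_pos_if_not_AE_zero:
  fixes g :: "'a \<Rightarrow> real"
  assumes "integrable M g" "AE z in M. 0 \<le> g z" "\<not> (AE z in M. g z = 0)"
  shows "0 < integral\<^sup>L M g"
  using assms integral_nonneg_eq_0_iff_AE[OF assms(1,2)] integral_nonneg_AE[OF assms(2)]
  by linarith

text \<open>
  A finite-temperature ensemble of an energy \<open>X\<close> on an infinite measure space. The infinite total mass
  drives the partition function to infinity as the inverse temperature \<open>k\<close> tends to \<open>0\<close>; the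
  last assumption, that \<open>a\<close> is the essential infimum of \<open>X\<close>, makes the ensemble concentrate at
  energy \<open>a\<close> as \<open>k\<close> tends to infinity. The quotient \<open>W k / Z k\<close> of the two integrals below
  is the mean of \<open>1 / X\<close> in the ensemble.
\<close>

locale gibbs_family =
  fixes \<nu> :: "'a measure" and X :: "'a \<Rightarrow> real" and a :: real
  assumes X_meas [measurable]: "X \<in> borel_measurable \<nu>"
    and a_pos: "0 < a"
    and X_ge: "AE z in \<nu>. a \<le> X z"
    and exp_integrable: "\<And>k. 0 < k \<Longrightarrow> integrable \<nu> (\<lambda>z. exp (- (k * X z)))"
    and infinite: "emeasure \<nu> (space \<nu>) = \<infinity>"
    and inf_X: "\<And>b. a < b \<Longrightarrow> emeasure \<nu> {z \<in> space \<nu>. X z < b} \<noteq> 0"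
begin

definition Z :: "real \<Rightarrow> real" where
  "Z k = (\<integral>z. exp (- (k * X z)) \<partial>\<nu>)"

definition W :: "real \<Rightarrow> real" where
  "W k = (\<integral>z. inverse (X z) * exp (- (k * X z)) \<partial>\<nu>)"

lemma inverse_exp_integrable:
  assumes "0 < k"
  shows "integrable \<nu> (\<lambda>z. inverse (X z) * exp (- (k * X z)))"
proof (rule Bochner_Integration.integrable_bound)
  show "integrable \<nu> (\<lambda>z. inverse a * exp (- (k * X z)))"
    using exp_integrable[OF assms] by simp
  show "AE z in \<nu>. norm (inverse (X z) * exp (- (k * X z))) \<le> norm (inverse a * exp (- (k * X z)))"
    using X_ge
  proof eventually_elim
    case (elim z)
    then have "inverse (X z) \<le> inverse a"
      using a_pos by (intro le_imp_inverse_le) auto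
    then show ?case using elim a_pos by (simp add: abs_mult)
  qed
qed simp

lemma not_AE_False: "\<not> (AE z in \<nu>. False)"
proof
  assume "AE z in \<nu>. False"
  then have "emeasure \<nu> (space \<nu>) = 0"
    by (subst (asm) AE_iff_measurable[OF sets.top]) auto
  then show False using infinite by simp
qed

lemma Z_pos: "0 < k \<Longrightarrow> 0 < Z k"
  unfolding Z_def using not_AE_False
  by (intro integral_pos_if_not_AE_zero exp_integrable) auto

lemma difference_integrable:
  assumes "0 < k"
  shows "integrable \<nu> (\<lambda>z. (inverse (X z) - r) * exp (- (k * X z)))"
  using inverse_exp_integrable[OF assms] exp_integrable[OF assms] by (simp add: left_diff_distrib)

lemma difference_eq:
  assumes "0 < k"
  shows "W k - r * Z k = (\<integral>z. (inverse (X z) - r) * exp (- (k * X z)) \<partial>\<nu>)"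
  using inverse_exp_integrable[OF assms] exp_integrable[OF assms]
  by (simp add: left_diff_distrib W_def Z_def)

lemma X_not_constant: "\<not> (AE z in \<nu>. X z = x)"
proof
  assume A: "AE z in \<nu>. X z = x"
  have "integrable \<nu> (\<lambda>z. exp (- (1 * X z)))" by (rule exp_integrable) simp
  then have "integrable \<nu> (\<lambda>z. exp (- x))"
    by (subst integrable_cong_AE[where g="\<lambda>z. exp (- (1 * X z))"]) (use A in auto)
  then have "integrable \<nu> (\<lambda>z. exp x * exp (- x))" by (rule integrable_mult_right)
  then have "integrable \<nu> (\<lambda>z. 1::real)" by (simp add: exp_minus)
  then have "emeasure \<nu> (space \<nu>) < \<infinity>" by (simp add: integrable_iff_bounded)
  then show False using infinite by simp
qed

text \<open>
  A Chebyshev-type argument. Put \<open>r = W k / Z k\<close>, so that \<open>(1 / X - r) * exp (- k * X)\<close> has integral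
  zero, and multiply it by \<open>exp (- (l - k) * X)\<close>. This factor and \<open>1 / X - r\<close> both decrease in
  \<open>X\<close>, hence subtracting from the factor its value at \<open>X = 1 / r\<close> leaves a product that is non-negative and
  vanishes only where \<open>X = 1 / r\<close>. Since \<open>X\<close> is not almost everywhere constant, the integral becomes positive.
\<close>

lemma ratio_strict_mono:
  assumes "0 < k" "k < l"
  shows "W k / Z k < W l / Z l"
proof -
  define r where "r = W k / Z k"
  have r: "W k - r * Z k = 0" using Z_pos[OF assms(1)] by (simp add: r_def)
  have l: "0 < l" using assms by simp
  have "0 < W k" unfolding W_def
  proof (rule integral_pos_if_not_AE_zero[OF inverse_exp_integrable[OF assms(1)]])
    show "AE z in \<nu>. 0 \<le> inverse (X z) * exp (- (k * X z))" using X_ge a_pos by auto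
    show "\<not> (AE z in \<nu>. inverse (X z) * exp (- (k * X z)) = 0)"
    proof
      assume "AE z in \<nu>. inverse (X z) * exp (- (k * X z)) = 0"
      with X_ge have "AE z in \<nu>. False" by eventually_elim (use a_pos in auto)
      then show False using not_AE_False by simp
    qed
  qed
  then have "r > 0" using Z_pos[OF assms(1)] by (simp add: r_def)
  define x where "x = inverse r"
  have x: "x > 0" "r = inverse x" using \<open>r > 0\<close> by (auto simp: x_def)
  define e where "e z = (inverse (X z) - r) * exp (- (l * X z))
      - exp (- ((l - k) * x)) * ((inverse (X z) - r) * exp (- (k * X z)))" for z
  have e_eq: "e z = (inverse (X z) - inverse x) * (exp (- ((l - k) * X z)) - exp (- ((l - k) * x)))
      * exp (- (k * X z))" for z
    by (simp add: e_def x algebra_simps flip: exp_add)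
  have int: "integrable \<nu> e"
    unfolding e_def using difference_integrable[OF assms(1)] difference_integrable[OF l] by simp
  have "0 < (\<integral>z. e z \<partial>\<nu>)"
  proof (rule integral_pos_if_not_AE_zero[OF int])
    show "AE z in \<nu>. 0 \<le> e z"
      using X_ge
    proof eventually_elim
      case (elim z)
      then have "X z > 0" using a_pos by simp
      then show ?case
        unfolding e_eq using x assms
        by (intro mult_nonneg_nonneg[OF _ exp_ge_zero], cases "X z \<le> x")
           (auto intro: mult_nonneg_nonneg mult_nonpos_nonpos simp: le_imp_inverse_le)
    qed
    show "\<not> (AE z in \<nu>. e z = 0)"
    proof
      assume "AE z in \<nu>. e z = 0"
      then have "AE z in \<nu>. X z = x"
        by eventually_elim (use assms in \<open>auto simp: e_eq\<close>)
      then show False using X_not_constant by simp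
    qed
  qed
  also have "(\<integral>z. e z \<partial>\<nu>) = (W l - r * Z l) - exp (- ((l - k) * x)) * (W k - r * Z k)"
    unfolding e_def difference_eq[OF assms(1)] difference_eq[OF l]
    using difference_integrable[OF assms(1)] difference_integrable[OF l] by simp
  finally have "r * Z l < W l" using r by simp
  then show ?thesis using Z_pos[OF l] by (simp add: r_def field_simps)
qed

text \<open>
  Convexity is the cheapest road to continuity in \<open>k\<close>: it passes through the integral pointwise, and a
  convex function on an open interval is continuous.
\<close>

lemma convex_exp_integral:
  assumes [measurable]: "w \<in> borel_measurable \<nu>" and w: "AE z in \<nu>. 0 \<le> w z"
    and int: "\<And>k. 0 < k \<Longrightarrow> integrable \<nu> (\<lambda>z. w z * exp (- (k * X z)))"
  shows "convex_on {0<..} (\<lambda>k. \<integral>z. w z * exp (- (k * X z)) \<partial>\<nu>)"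
proof (rule convex_onI)
  fix t k l :: real
  assume t: "0 < t" "t < 1" and kl: "k \<in> {0<..}" "l \<in> {0<..}"
  have pos: "0 < (1 - t) * k + t * l" using t kl by (simp add: add_pos_pos)
  have "(\<integral>z. w z * exp (- (((1 - t) *\<^sub>R k + t *\<^sub>R l) * X z)) \<partial>\<nu>) \<le>
      (\<integral>z. (1 - t) * (w z * exp (- (k * X z))) + t * (w z * exp (- (l * X z))) \<partial>\<nu>)"
  proof (rule integral_mono_AE)
    show "AE z in \<nu>. w z * exp (- (((1 - t) *\<^sub>R k + t *\<^sub>R l) * X z))
       \<le> (1 - t) * (w z * exp (- (k * X z))) + t * (w z * exp (- (l * X z)))"
      using w
    proof eventually_elim
      case (elim z)
      have "exp ((1 - t) *\<^sub>R (- (k * X z)) + t *\<^sub>R (- (l * X z)))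
          \<le> (1 - t) * exp (- (k * X z)) + t * exp (- (l * X z))"
        using t by (intro convex_onD[OF exp_convex]) auto
      from mult_left_mono[OF this elim] show ?case by (simp add: algebra_simps)
    qed
  qed (use int kl pos in auto)
  also have "\<dots> = (1 - t) * (\<integral>z. w z * exp (- (k * X z)) \<partial>\<nu>) + t * (\<integral>z. w z * exp (- (l * X z)) \<partial>\<nu>)"
    using int kl by simp
  finally show "(\<integral>z. w z * exp (- (((1 - t) *\<^sub>R k + t *\<^sub>R l) * X z)) \<partial>\<nu>) \<le>
      (1 - t) * (\<integral>z. w z * exp (- (k * X z)) \<partial>\<nu>) + t * (\<integral>z. w z * exp (- (l * X z)) \<partial>\<nu>)" .
qed simp

lemma ratio_continuous: "continuous_on {0<..} (\<lambda>k. W k / Z k)"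
proof (rule continuous_on_divide)
  show "continuous_on {0<..} W"
    unfolding W_def[abs_def] using X_ge a_pos inverse_exp_integrable
    by (intro convex_on_continuous convex_exp_integral) auto
  show "continuous_on {0<..} Z"
    unfolding Z_def[abs_def] using convex_exp_integral[of "\<lambda>_. 1"] exp_integrable
    by (intro convex_on_continuous) auto
qed (use Z_pos in force)

text \<open>
  Along \<open>k = 1 / (n + 1)\<close> the integrands increase to \<open>1\<close>, so that the integrals increase to the total
  mass, which is infinite.
\<close>

lemma Z_unbounded: "\<exists>k>0. C < Z k"
proof (rule ccontr)
  assume "\<not> ?thesis"
  then have le: "Z k \<le> C" if "0 < k" for k using that by force
  have "emeasure \<nu> (space \<nu>) = (\<integral>\<^sup>+z. (SUP n. ennreal (exp (- (inverse (real (Suc n)) * X z)))) \<partial>\<nu>)"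
  proof -
    have "(SUP n. ennreal (exp (- (inverse (real (Suc n)) * x)))) = 1" if "0 \<le> x" for x
    proof (rule LIMSEQ_unique[OF LIMSEQ_SUP])
      show "incseq (\<lambda>n. ennreal (exp (- (inverse (real (Suc n)) * x))))"
        using that by (auto simp: incseq_def intro!: ennreal_leI mult_right_mono le_imp_inverse_le)
      have "(\<lambda>n. exp (- (inverse (real (Suc n)) * x))) \<longlonglongrightarrow> exp (- (0 * x))"
        by (intro tendsto_intros LIMSEQ_inverse_real_of_nat)
      from tendsto_ennrealI[OF this]
      show "(\<lambda>n. ennreal (exp (- (inverse (real (Suc n)) * x)))) \<longlonglongrightarrow> 1" by simp
    qed
    then have "(\<integral>\<^sup>+z. (SUP n. ennreal (exp (- (inverse (real (Suc n)) * X z)))) \<partial>\<nu>) = (\<integral>\<^sup>+z. 1 \<partial>\<nu>)"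
      using X_ge a_pos by (intro nn_integral_cong_AE) auto
    then show ?thesis by simp
  qed
  also have "\<dots> = (SUP n. \<integral>\<^sup>+z. ennreal (exp (- (inverse (real (Suc n)) * X z))) \<partial>\<nu>)"
  proof (rule nn_integral_monotone_convergence_SUP_AE)
    show "AE z in \<nu>. ennreal (exp (- (inverse (real (Suc i)) * X z)))
        \<le> ennreal (exp (- (inverse (real (Suc (Suc i))) * X z)))" for i
      using X_ge
    proof eventually_elim
      case (elim z)
      then show ?case using a_pos
        by (intro ennreal_leI) (auto intro!: mult_right_mono le_imp_inverse_le)
    qed
  qed simp
  also have "\<dots> = (SUP n. ennreal (Z (inverse (real (Suc n)))))"
    unfolding Z_def by (intro SUP_cong refl nn_integral_eq_integral exp_integrable) auto
  also have "\<dots> \<le> ennreal C"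
    by (intro SUP_least ennreal_leI le) simp
  finally show False using infinite by (simp add: top_unique)
qed

text \<open>
  On \<open>X > 2 / r\<close> the function \<open>1 / X\<close> is below \<open>r / 2\<close>, while the part \<open>X \<le> 2 / r\<close> contributes to \<open>W k\<close>
  an amount that is bounded uniformly in \<open>k\<close>. Hence \<open>W k \<le> const + r / 2 * Z k\<close>, and \<open>Z k\<close> can be
  made as large as desired.
\<close>

lemma ratio_small:
  assumes "0 < r"
  shows "\<exists>k>0. W k / Z k < r"
proof -
  \<comment> \<open>The constant for which the uniformly bounded contribution equals \<open>r / 2 * C\<close>.\<close>
  define C where "C = exp (2 / r) * W 1 * (2 / r)"
  obtain k where k: "0 < k" "C < Z k" using Z_unbounded by blast
  have "W k \<le> (\<integral>z. exp (2 / r) * (inverse (X z) * exp (- (1 * X z))) + r / 2 * exp (- (k * X z)) \<partial>\<nu>)"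
    unfolding W_def
  proof (rule integral_mono_AE)
    show "AE z in \<nu>. inverse (X z) * exp (- (k * X z))
        \<le> exp (2 / r) * (inverse (X z) * exp (- (1 * X z))) + r / 2 * exp (- (k * X z))"
      using X_ge
    proof eventually_elim
      case (elim z)
      then have X: "0 < X z" using a_pos by simp
      show ?case
      proof (cases "X z \<le> 2 / r")
        case True
        have "exp (- (k * X z)) \<le> 1" using k X by simp
        also have "1 \<le> exp (2 / r) * exp (- (1 * X z))" using True by (simp flip: exp_add)
        finally have "inverse (X z) * exp (- (k * X z)) \<le> inverse (X z) * (exp (2 / r) * exp (- (1 * X z)))"
          using X by (intro mult_left_mono) auto
        also have "\<dots> \<le> exp (2 / r) * (inverse (X z) * exp (- (1 * X z))) + r / 2 * exp (- (k * X z))"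
          using assms by simp
        finally show ?thesis .
      next
        case False
        then have "inverse (X z) \<le> r / 2" using assms X by (simp add: field_simps)
        then have "inverse (X z) * exp (- (k * X z)) \<le> r / 2 * exp (- (k * X z))"
          by (intro mult_right_mono) auto
        then show ?thesis using X by (simp add: add_increasing)
      qed
    qed
  qed (use inverse_exp_integrable[of 1] inverse_exp_integrable[OF k(1)] exp_integrable[OF k(1)] in auto)
  also have "\<dots> = exp (2 / r) * W 1 + r / 2 * Z k"
    using inverse_exp_integrable[of 1] exp_integrable[OF k(1)] by (simp add: W_def Z_def)
  also have "\<dots> = r / 2 * C + r / 2 * Z k" using assms by (simp add: C_def)
  also have "\<dots> < r / 2 * Z k + r / 2 * Z k"
    using k assms by (intro add_strict_right_mono mult_strict_left_mono) auto
  also have "\<dots> = r * Z k" by simp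
  finally show ?thesis using k Z_pos[OF k(1)] by (auto simp: field_simps)
qed

text \<open>
  With \<open>x = 1 / r > a\<close>, multiply \<open>(1 / X - r) * exp (- k * X)\<close> by \<open>exp (k * x)\<close>. Where \<open>X > x\<close>
  the product is negative, but its size decreases in \<open>k\<close>; where \<open>X < x\<close>, a set of positive measure, it is
  positive and grows at least linearly in \<open>k\<close>. So the integral is positive for large \<open>k\<close>.
\<close>

lemma ratio_large:
  assumes "0 < r" "r < inverse a"
  shows "\<exists>k>0. r < W k / Z k"
proof -
  define x where "x = inverse r"
  have x: "a < x" "r = inverse x" "0 < x"
    using assms a_pos by (auto simp: x_def field_simps)
  define g where "g z = (inverse (X z) - r) * exp (- (1 * X z))" for z
  \<comment> \<open>The rate of the linear growth in \<open>k\<close>; it is supported on \<open>X < x\<close>.\<close>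
  define h where "h z = g z * max 0 (x - X z)" for z
  have [measurable]: "g \<in> borel_measurable \<nu>" "h \<in> borel_measurable \<nu>"
    unfolding g_def[abs_def] h_def[abs_def] by measurable
  have g: "integrable \<nu> g" unfolding g_def by (rule difference_integrable) simp
  have h: "integrable \<nu> h"
  proof (rule Bochner_Integration.integrable_bound)
    show "integrable \<nu> (\<lambda>z. x * g z)" using g by simp
    show "AE z in \<nu>. norm (h z) \<le> norm (x * g z)"
      using X_ge
    proof eventually_elim
      case (elim z)
      then have "\<bar>g z\<bar> * max 0 (x - X z) \<le> \<bar>g z\<bar> * x"
        using a_pos x by (intro mult_left_mono) auto
      then show ?case using x by (simp add: h_def abs_mult mult.commute)
    qed
  qed simp
  have g_nonneg: "0 \<le> g z" if "X z \<le> x" "0 < X z" for z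
    using that x by (auto simp: g_def intro!: mult_nonneg_nonneg le_imp_inverse_le)
  have "0 < (\<integral>z. h z \<partial>\<nu>)"
  proof (rule integral_pos_if_not_AE_zero[OF h])
    show "AE z in \<nu>. 0 \<le> h z"
      using X_ge by eventually_elim (use a_pos g_nonneg in \<open>auto simp: h_def max_def\<close>)
    show "\<not> (AE z in \<nu>. h z = 0)"
    proof
      assume "AE z in \<nu>. h z = 0"
      with X_ge have "AE z in \<nu>. \<not> X z < x"
        by eventually_elim (use a_pos x in \<open>auto simp: h_def g_def max_def split: if_splits\<close>)
      then have "emeasure \<nu> {z \<in> space \<nu>. X z < x} = 0"
        by (subst (asm) AE_iff_measurable[where N="{z \<in> space \<nu>. X z < x}"]) auto
      then show False using inf_X[OF x(1)] by simp
    qed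
  qed
  then obtain n :: nat where n: "- (\<integral>z. g z \<partial>\<nu>) < real n * (\<integral>z. h z \<partial>\<nu>)"
    using ex_less_of_nat_mult by blast
  define k where "k = 1 + real n"
  have k: "0 < k" by (simp add: k_def)
  have "0 < (\<integral>z. g z + real n * h z \<partial>\<nu>)" using n g h by simp
  also have "\<dots> \<le> (\<integral>z. exp (real n * x) * ((inverse (X z) - r) * exp (- (k * X z))) \<partial>\<nu>)"
  proof (rule integral_mono_AE)
    show "AE z in \<nu>. g z + real n * h z \<le> exp (real n * x) * ((inverse (X z) - r) * exp (- (k * X z)))"
      using X_ge
    proof eventually_elim
      case (elim z)
      then have X: "0 < X z" using a_pos by simp
      have eq: "exp (real n * x) * ((inverse (X z) - r) * exp (- (k * X z))) = g z * exp (real n * (x - X z))"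
        by (simp add: g_def k_def algebra_simps flip: exp_add)
      show ?case
      proof (cases "X z \<le> x")
        case True
        have "g z * (1 + real n * (x - X z)) \<le> g z * exp (real n * (x - X z))"
          using g_nonneg[OF True X] by (intro mult_left_mono exp_ge_add_one_self)
        then show ?thesis unfolding eq using True by (simp add: h_def max_def algebra_simps)
      next
        case False
        have "g z \<le> 0"
          using False x X by (auto simp: g_def intro!: mult_nonpos_nonneg le_imp_inverse_le)
        moreover have "exp (real n * (x - X z)) \<le> 1" using False by (simp add: mult_nonneg_nonpos)
        ultimately have "g z * 1 \<le> g z * exp (real n * (x - X z))" by (intro mult_left_mono_neg)
        then show ?thesis unfolding eq using False by (simp add: h_def max_def)
      qed
    qed
  qed (use g h difference_integrable[OF k] in auto)
  also have "\<dots> = exp (real n * x) * (W k - r * Z k)"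
    by (simp add: difference_eq[OF k])
  finally have "0 < W k - r * Z k" by (simp add: zero_less_mult_iff)
  then show ?thesis using k Z_pos[OF k] by (auto simp: field_simps)
qed

theorem ratio_unique_root:
  assumes "0 < y" "y < inverse a"
  shows "\<exists>!k. 0 < k \<and> W k / Z k = y"
proof (rule ex_ex1I)
  obtain k l where k: "0 < k" "W k / Z k < y" and l: "0 < l" "y < W l / Z l"
    using ratio_small[OF assms(1)] ratio_large[OF assms] by blast
  have "k < l"
    using ratio_strict_mono[OF l(1), of k] k l by (cases k l rule: linorder_cases) auto
  moreover have "continuous_on {k..l} (\<lambda>k. W k / Z k)"
    using k by (intro continuous_on_subset[OF ratio_continuous]) auto
  ultimately obtain x where "k \<le> x" "W x / Z x = y"
    using IVT'[of "\<lambda>k. W k / Z k" k y l] k l by fastforce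
  then show "\<exists>k. 0 < k \<and> W k / Z k = y" using k by (intro exI[of _ x]) auto
next
  fix k l assume "0 < k \<and> W k / Z k = y" "0 < l \<and> W l / Z l = y"
  then show "k = l"
    using ratio_strict_mono[of k l] ratio_strict_mono[of l k] by (cases k l rule: linorder_cases) auto
qed

end

section \<open>Lorentz boosts and the invariant measure on the mass shell\<close>

lemma energy0_sq: "(energy0 m c p)\<^sup>2 = (m * c)\<^sup>2 + (norm p)\<^sup>2"
  by (simp add: energy0_def)

lemma energy0_pos: "m * c \<noteq> 0 \<Longrightarrow> 0 < energy0 m c p"
  by (simp add: energy0_def add_pos_nonneg)

lemma energy0_ge_mass: "m * c \<le> energy0 m c p"
  unfolding energy0_def by (rule real_le_rsqrt) simp

lemma energy0_ge_norm: "norm p \<le> energy0 m c p"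
  unfolding energy0_def by (rule real_le_rsqrt) simp

lemma continuous_energy0 [continuous_intros]:
  "continuous_on A f \<Longrightarrow> continuous_on A (\<lambda>x. energy0 m c (f x))"
  unfolding energy0_def by (intro continuous_intros)

lemma borel_measurable_energy0 [measurable]: "energy0 m c \<in> borel_measurable borel"
  by (intro borel_measurable_continuous_onI continuous_intros)

text \<open>
  Velocities are measured in units of \<open>c\<close>: the four-velocity is \<open>c * (lorentz_factor u, u)\<close>.
\<close>

definition lorentz_factor :: "real ^ 3 \<Rightarrow> real" where
  "lorentz_factor u = sqrt (1 + (norm u)\<^sup>2)"

text \<open>
  The spatial part of the pure Lorentz transformation that carries the four-velocity of \<open>u\<close> to rest, written as a
  map of the mass shell in the coordinate \<open>p\<close>. The usual coefficient \<open>(lorentz_factor u - 1) / (norm u)\<^sup>2\<close> of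
  \<open>inner u p\<close> has been rewritten as \<open>1 / (1 + lorentz_factor u)\<close>, which also covers \<open>u = 0\<close>.
\<close>

definition boost :: "real \<Rightarrow> real \<Rightarrow> real ^ 3 \<Rightarrow> real ^ 3 \<Rightarrow> real ^ 3" where
  "boost m c u p = p + (inner u p / (1 + lorentz_factor u) - energy0 m c p) *\<^sub>R u"

lemma lorentz_factor_ge: "1 \<le> lorentz_factor u"
  by (simp add: lorentz_factor_def)

lemma lorentz_factor_uminus [simp]: "lorentz_factor (- u) = lorentz_factor u"
  by (simp add: lorentz_factor_def)

lemma norm_sq_conv_lorentz_factor: "inner u u = (lorentz_factor u + 1) * (lorentz_factor u - 1)"
  by (simp add: lorentz_factor_def dot_square_norm algebra_simps)

lemma norm_less_lorentz_factor: "norm u < lorentz_factor u"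
  unfolding lorentz_factor_def by (rule real_less_rsqrt) simp

lemma energy0_boost_pos:
  assumes "m * c \<noteq> 0"
  shows "0 < lorentz_factor u * energy0 m c p - inner u p"
proof -
  have "inner u p \<le> norm u * norm p" by (rule norm_cauchy_schwarz)
  also have "\<dots> \<le> norm u * energy0 m c p" by (intro mult_left_mono energy0_ge_norm) simp
  also have "\<dots> < lorentz_factor u * energy0 m c p"
    by (intro mult_strict_right_mono norm_less_lorentz_factor energy0_pos assms)
  finally show ?thesis by simp
qed

text \<open>
  The boosted energy is the time component of the transformed four-momentum, because the transformation preserves
  the mass shell. The computation squares both sides and uses \<open>norm_sq_conv_lorentz_factor\<close>; the sign of the root is
  settled by the Cauchy-Schwarz inequality in \<open>energy0_boost_pos\<close>.
\<close>

lemma energy0_boost: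
  assumes "m * c \<noteq> 0"
  shows "energy0 m c (boost m c u p) = lorentz_factor u * energy0 m c p - inner u p"
proof -
  define g e x where "g = lorentz_factor u" and "e = energy0 m c p" and "x = inner u p"
  have g: "0 < 1 + g" using lorentz_factor_ge[of u] by (simp add: g_def)
  have uu: "inner u u = (g + 1) * (g - 1)" by (simp add: g_def norm_sq_conv_lorentz_factor)
  have e: "e\<^sup>2 = (m * c)\<^sup>2 + (norm p)\<^sup>2" by (simp add: e_def energy0_sq)
  define l where "l = x / (1 + g) - e"
  have l: "(1 + g) * l = x - (1 + g) * e" using g by (simp add: l_def field_simps)
  have "(energy0 m c (boost m c u p))\<^sup>2 = (m * c)\<^sup>2 + inner (p + l *\<^sub>R u) (p + l *\<^sub>R u)"
    by (simp add: energy0_sq boost_def dot_square_norm l_def g_def e_def x_def)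
  also have "\<dots> = (m * c)\<^sup>2 + (norm p)\<^sup>2 + 2 * l * x + l * ((1 + g) * l) * (g - 1)"
    by (simp add: inner_add_left inner_add_right uu dot_square_norm[symmetric] inner_commute x_def
        algebra_simps)
  also have "\<dots> = e\<^sup>2 + 2 * l * x + l * (x - (1 + g) * e) * (g - 1)"
    unfolding l e by simp
  also have "\<dots> = e\<^sup>2 + ((1 + g) * l) * x - ((1 + g) * l) * e * (g - 1)"
    by (simp add: algebra_simps)
  also have "\<dots> = (g * e - x)\<^sup>2"
    unfolding l by (simp add: power2_eq_square algebra_simps)
  finally have "(energy0 m c (boost m c u p))\<^sup>2 = (g * e - x)\<^sup>2" .
  moreover have "0 < g * e - x" using energy0_boost_pos[OF assms] by (simp add: g_def e_def x_def)
  ultimately show ?thesis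
    using energy0_pos[OF assms, of "boost m c u p"] by (simp add: g_def e_def x_def power2_eq_iff_nonneg)
qed

lemma boost_boost_uminus:
  assumes "m * c \<noteq> 0"
  shows "boost m c (- u) (boost m c u p) = p"
proof -
  define g e x where "g = lorentz_factor u" and "e = energy0 m c p" and "x = inner u p"
  have g: "0 < 1 + g" using lorentz_factor_ge[of u] by (simp add: g_def)
  have uu: "inner u u = (g + 1) * (g - 1)" by (simp add: g_def norm_sq_conv_lorentz_factor)
  define l where "l = x / (1 + g) - e"
  have l: "(1 + g) * l = x - (1 + g) * e" using g by (simp add: l_def field_simps)
  have b: "boost m c u p = p + l *\<^sub>R u" by (simp add: boost_def l_def g_def e_def x_def)
  have "inner u (p + l *\<^sub>R u) = x + ((1 + g) * l) * (g - 1)"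
    by (simp add: inner_add_right uu x_def algebra_simps)
  also have "\<dots> = (1 + g) * (x / (1 + g) + l * (g - 1))"
    using g by (simp add: field_simps)
  finally have i: "inner u (p + l *\<^sub>R u) / (1 + g) = x / (1 + g) + l * (g - 1)" using g by simp
  have "l - (- (inner u (p + l *\<^sub>R u) / (1 + g)) - (g * e - x)) = 0"
  proof -
    have "l - (- (inner u (p + l *\<^sub>R u) / (1 + g)) - (g * e - x)) = x / (1 + g) + g * l + g * e - x"
      unfolding i by (simp add: algebra_simps)
    also have "\<dots> = x / (1 + g) + ((1 + g) * l - l) + g * e - x" by (simp add: algebra_simps)
    also have "\<dots> = 0" unfolding l unfolding l_def by (simp add: algebra_simps)
    finally show ?thesis .
  qed
  moreover have "boost m c (- u) (boost m c u p)
      = p + (l - (- (inner u (p + l *\<^sub>R u) / (1 + g)) - (g * e - x))) *\<^sub>R u"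
    unfolding boost_def[of m c "- u"] energy0_boost[OF assms] unfolding b
    by (simp add: g_def e_def x_def scaleR_diff_left)
  ultimately show ?thesis by simp
qed

lemma bij_boost:
  assumes "m * c \<noteq> 0"
  shows "inj (boost m c u)" "surj (boost m c u)"
  using boost_boost_uminus[OF assms, of u] boost_boost_uminus[OF assms, of "- u"]
  by (metis injI, metis surjI minus_minus)

text \<open>
  A rank-one perturbation of the identity, because \<open>boost\<close> moves \<open>p\<close> only along \<open>u\<close>.
\<close>

definition boost_derivative :: "real \<Rightarrow> real \<Rightarrow> real ^ 3 \<Rightarrow> real ^ 3 \<Rightarrow> real ^ 3 \<Rightarrow> real ^ 3" where
  "boost_derivative m c u p h =
     h + inner ((1 / (1 + lorentz_factor u)) *\<^sub>R u - (1 / energy0 m c p) *\<^sub>R p) h *\<^sub>R u"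

lemma has_derivative_energy0:
  assumes "m * c \<noteq> 0"
  shows "(energy0 m c has_derivative (\<lambda>h. inner p h / energy0 m c p)) (at p within S)"
proof -
  have "0 < (m * c)\<^sup>2 + inner p p" using assms by (simp add: add_pos_nonneg)
  then show ?thesis
    unfolding energy0_def[abs_def] power2_norm_eq_inner
    by (auto intro!: derivative_eq_intros simp: inner_commute) (simp only: divide_inverse)
qed

lemma has_derivative_boost:
  assumes "m * c \<noteq> 0"
  shows "(boost m c u has_derivative boost_derivative m c u p) (at p within S)"
  unfolding boost_def[abs_def] boost_derivative_def[abs_def] divide_inverse
  by (rule derivative_eq_intros has_derivative_energy0[OF assms] refl)+
     (auto simp: inner_diff_right inner_commute mult.commute simp flip: divide_inverse)

lemma det_identity_plus_rank_one:
  fixes u v :: "real ^ 3"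
  shows "det (matrix (\<lambda>h. h + inner v h *\<^sub>R u)) = 1 + inner v u"
  by (simp add: det_3 matrix_def inner_vec_def sum_3 axis_def) (simp add: algebra_simps)

text \<open>
  The Jacobian of the boost is the quotient of the new and the old energy; this is the reason for the
  Lorentz invariance of \<open>dp / p\<^sup>0\<close>.
\<close>

lemma det_boost_derivative:
  assumes "m * c \<noteq> 0"
  shows "det (matrix (boost_derivative m c u p)) = energy0 m c (boost m c u p) / energy0 m c p"
proof -
  have g: "0 < 1 + lorentz_factor u" using lorentz_factor_ge[of u] by simp
  have "det (matrix (boost_derivative m c u p))
      = 1 + inner ((1 / (1 + lorentz_factor u)) *\<^sub>R u - (1 / energy0 m c p) *\<^sub>R p) u"
    unfolding boost_derivative_def[abs_def] by (rule det_identity_plus_rank_one)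
  also have "\<dots> = lorentz_factor u - inner u p / energy0 m c p"
    using g by (simp add: inner_diff_left norm_sq_conv_lorentz_factor inner_commute[of p] field_simps)
  also have "\<dots> = energy0 m c (boost m c u p) / energy0 m c p"
    using energy0_pos[OF assms, of p] by (simp add: energy0_boost[OF assms] field_simps)
  finally show ?thesis .
qed

text \<open>
  The change of variables formula for a differentiable bijection as an identity of measures, which can be applied
  to integrands of any kind. It is enough to compare the measures on bounded boxes.
\<close>

lemma distr_density_det_eq_lborel:
  fixes g :: "real ^ 'n::{finite,wellorder} \<Rightarrow> real ^ 'n::_"
  assumes der: "\<And>x. (g has_derivative g' x) (at x)"
    and g: "inj g" "surj g" and [measurable]: "g \<in> borel_measurable borel"
    and det [measurable]: "(\<lambda>x. det (matrix (g' x))) \<in> borel_measurable borel"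
  shows "distr (density lborel (\<lambda>x. \<bar>det (matrix (g' x))\<bar>)) lborel g = lborel"
proof (rule sym, rule lborel_eqI)
  fix l u :: "real ^ 'n::_"
  assume lu: "\<And>b. b \<in> Basis \<Longrightarrow> inner l b \<le> inner u b"
  define S where "S = g -` box l u"
  have [measurable]: "S \<in> sets borel"
    unfolding S_def using measurable_sets[OF assms(4), of "box l u"] by simp
  have image: "g ` S = box l u" unfolding S_def using g(2) by (rule surj_image_vimage_eq)
  define v where "v = measure lebesgue (box l u)"
  have "((\<lambda>x. \<bar>det (matrix (g' x))\<bar>) has_integral v) S"
  proof (subst has_measure_differentiable_image[symmetric])
    show "S \<in> sets lebesgue" by simp
    show "(g has_derivative g' x) (at x within S)" for x
      using der by (rule has_derivative_at_withinI)
    show "inj_on g S" using g(1) by (rule inj_on_subset) simp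
    show "g ` S \<in> lmeasurable \<and> measure lebesgue (g ` S) = v"
      unfolding image v_def by simp
  qed
  then have "(\<integral>\<^sup>+x. ennreal \<bar>det (matrix (g' x))\<bar> * indicator S x \<partial>lborel) = v"
    by (intro nn_integral_has_integral_lebesgue') auto
  moreover have "ennreal v = emeasure lborel (box l u)"
    unfolding v_def by (simp add: emeasure_eq_measure2[OF fmeasurable_box])
  ultimately show "emeasure (distr (density lborel (\<lambda>x. \<bar>det (matrix (g' x))\<bar>)) lborel g) (box l u)
      = (\<Prod>b\<in>Basis. inner (u - l) b)"
    using lu by (simp add: emeasure_distr emeasure_density S_def[symmetric] emeasure_lborel_box)
qed simp

text \<open>
  The Lorentz invariant measure \<open>dp / p\<^sup>0\<close> on the mass shell.
\<close>

definition mass_shell_measure :: "real \<Rightarrow> real \<Rightarrow> (real ^ 3) measure" where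
  "mass_shell_measure m c = density lborel (\<lambda>p. ennreal (1 / energy0 m c p))"

lemma borel_measurable_boost [measurable]: "boost m c u \<in> borel_measurable borel"
  unfolding boost_def[abs_def] by measurable

lemma distr_boost_mass_shell_measure:
  assumes mc: "m * c \<noteq> 0"
  shows "distr (mass_shell_measure m c) borel (boost m c u) = mass_shell_measure m c"
proof -
  let ?d = "\<lambda>p. \<bar>det (matrix (boost_derivative m c u p))\<bar>"
  have d: "?d p = energy0 m c (boost m c u p) / energy0 m c p" for p
    using energy0_pos[OF mc, of p] energy0_pos[OF mc, of "boost m c u p"]
    by (simp add: det_boost_derivative[OF mc])
  have lb: "distr (density lborel ?d) lborel (boost m c u) = lborel"
    by (rule distr_density_det_eq_lborel)
       (use has_derivative_boost[OF mc] bij_boost[OF mc] in \<open>auto simp: det_boost_derivative[OF mc]\<close>)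
  show ?thesis
  proof (rule measure_eqI)
    fix A assume "A \<in> sets (distr (mass_shell_measure m c) borel (boost m c u))"
    then have [measurable]: "A \<in> sets borel" by simp
    have "emeasure (mass_shell_measure m c) A
        = (\<integral>\<^sup>+q. ennreal (1 / energy0 m c q) * indicator A q \<partial>distr (density lborel ?d) lborel (boost m c u))"
      unfolding lb by (simp add: mass_shell_measure_def emeasure_density)
    also have "\<dots> = (\<integral>\<^sup>+p. ennreal (?d p) *
        (ennreal (1 / energy0 m c (boost m c u p)) * indicator A (boost m c u p)) \<partial>lborel)"
      unfolding d by (simp add: nn_integral_distr nn_integral_density)
    also have "\<dots> = (\<integral>\<^sup>+p. ennreal (1 / energy0 m c p) * indicator (boost m c u -` A) p \<partial>lborel)"
    proof (rule nn_integral_cong)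
      fix p
      have e: "0 < energy0 m c p" "0 < energy0 m c (boost m c u p)"
        using energy0_pos[OF mc] by blast+
      have "ennreal (?d p) * ennreal (1 / energy0 m c (boost m c u p)) = ennreal (1 / energy0 m c p)"
        unfolding d using e by (simp flip: ennreal_mult)
      then show "ennreal (?d p) * (ennreal (1 / energy0 m c (boost m c u p)) * indicator A (boost m c u p))
          = ennreal (1 / energy0 m c p) * indicator (boost m c u -` A) p"
        by (simp add: indicator_def flip: mult.assoc)
    qed
    also have "\<dots> = emeasure (distr (mass_shell_measure m c) borel (boost m c u)) A"
    proof -
      have [measurable]: "boost m c u -` A \<in> sets borel"
        using measurable_sets[OF borel_measurable_boost \<open>A \<in> sets borel\<close>, of m c u] by simp
      show ?thesis by (simp add: mass_shell_measure_def emeasure_distr emeasure_density)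
    qed
    finally show "emeasure (distr (mass_shell_measure m c) borel (boost m c u)) A
        = emeasure (mass_shell_measure m c) A" by simp
  qed (simp add: mass_shell_measure_def)
qed

lemma energy0_uminus [simp]: "energy0 m c (- p) = energy0 m c p"
  by (simp add: energy0_def)

lemma distr_uminus_mass_shell_measure:
  "distr (mass_shell_measure m c) borel uminus = mass_shell_measure m c"
proof -
  have lb: "distr lborel borel (uminus :: real ^ 3 \<Rightarrow> real ^ 3) = lborel"
    using lborel_affine[of "-1" "0 :: real ^ 3", symmetric] by (simp add: density_1)
  show ?thesis
  proof (rule measure_eqI)
    fix A assume "A \<in> sets (distr (mass_shell_measure m c) borel uminus)"
    then have [measurable]: "A \<in> sets borel" by simp
    have "emeasure (mass_shell_measure m c) A
        = (\<integral>\<^sup>+q. ennreal (1 / energy0 m c q) * indicator A q \<partial>distr lborel borel uminus)"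
      unfolding lb by (simp add: mass_shell_measure_def emeasure_density)
    also have "\<dots> = (\<integral>\<^sup>+p. ennreal (1 / energy0 m c p) * indicator (uminus -` A) p \<partial>lborel)"
      by (simp add: nn_integral_distr indicator_def)
    also have "\<dots> = emeasure (distr (mass_shell_measure m c) borel uminus) A"
    proof -
      have [measurable]: "uminus -` A \<in> sets borel"
        using measurable_sets[of "uminus :: real ^ 3 \<Rightarrow> _" borel borel A] by simp
      show ?thesis by (simp add: mass_shell_measure_def emeasure_distr emeasure_density)
    qed
    finally show "emeasure (distr (mass_shell_measure m c) borel uminus) A
        = emeasure (mass_shell_measure m c) A" by simp
  qed (simp add: mass_shell_measure_def)
qed

section \<open>Phase space as a product of Borel measures\<close>

lemma borel_fst_snd [measurable]:
  "fst \<in> borel_measurable (borel :: ((real ^ 3) \<times> real) measure)"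
  "snd \<in> borel_measurable (borel :: ((real ^ 3) \<times> real) measure)"
  by (auto simp: borel_prod[symmetric])

text \<open>
  The measure \<open>\<phi>(I) dI\<close> on the half-line, extended by zero to the whole line so that it lives on the Borel sets of
  the reals.
\<close>

definition internal_measure :: "real \<Rightarrow> real measure" where
  "internal_measure \<sigma> = density lborel (\<lambda>I. ennreal (indicator {0<..} I * I powr \<sigma>))"

lemma sets_internal_measure [measurable_cong, simp]: "sets (internal_measure \<sigma>) = sets borel"
  by (simp add: internal_measure_def)

lemma space_internal_measure [simp]: "space (internal_measure \<sigma>) = UNIV"
  by (simp add: internal_measure_def)

lemma sigma_finite_internal_measure: "sigma_finite_measure (internal_measure \<sigma>)"
  unfolding internal_measure_def
  by (subst sigma_finite_measure.sigma_finite_iff_density_finite[OF sigma_finite_lborel]) auto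

lemma sets_mass_shell_measure [measurable_cong, simp]: "sets (mass_shell_measure m c) = sets borel"
  by (simp add: mass_shell_measure_def)

lemma borel_measurable_state_density [measurable]: "state_density \<sigma> \<in> borel_measurable borel"
  unfolding state_density_def[abs_def] by measurable

lemma pair_internal_measure_eq:
  fixes w :: "real ^ 3 \<Rightarrow> real"
  assumes [measurable]: "w \<in> borel_measurable borel" and w: "\<And>p. 0 \<le> w p"
  shows "density lborel (\<lambda>p. ennreal (w p)) \<Otimes>\<^sub>M internal_measure \<sigma>
    = density lborel (\<lambda>z. ennreal (indicator (UNIV \<times> {0<..}) z * (snd z powr \<sigma> * w (fst z))))"
proof -
  have "density lborel (\<lambda>p. ennreal (w p)) \<Otimes>\<^sub>M internal_measure \<sigma>
      = density (lborel \<Otimes>\<^sub>M lborel)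
          (\<lambda>(p, I). ennreal (w p) * ennreal (indicator {0<..} I * I powr \<sigma>))"
    unfolding internal_measure_def
    by (rule pair_measure_density)
       (use sigma_finite_internal_measure[of \<sigma>] sigma_finite_lborel in
         \<open>auto simp: internal_measure_def\<close>)
  also have "\<dots> = density lborel (\<lambda>z. ennreal (indicator (UNIV \<times> {0<..}) z * (snd z powr \<sigma> * w (fst z))))"
    unfolding lborel_prod
    by (rule arg_cong[where f="density lborel"])
       (auto simp: fun_eq_iff indicator_def w mult.commute simp flip: ennreal_mult)
  finally show ?thesis .
qed

text \<open>
  The Lebesgue sigma-algebra of the phase space is larger than a product of sigma-algebras. For Borel integrands its integrals are
  integrals for a product of Borel measures, to which Fubini's theorem and the transport by a boost of
  the momentum apply; this is where the equilibrium distributions are treated. The weight \<open>w\<close> will be \<open>1\<close> or \<open>1 / p\<^sup>0\<close>.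
\<close>

lemma has_bochner_integral_phase_measure_iff:
  fixes w :: "real ^ 3 \<Rightarrow> real" and g :: "(real ^ 3) \<times> real \<Rightarrow> 'b :: {banach, second_countable_topology}"
  assumes [measurable]: "w \<in> borel_measurable borel" and w: "\<And>p. 0 \<le> w p"
    and [measurable]: "g \<in> borel_measurable borel"
  shows "has_bochner_integral phase_measure (\<lambda>(p, I). (state_density \<sigma> I * w p) *\<^sub>R g (p, I)) v
    \<longleftrightarrow> has_bochner_integral (density lborel (\<lambda>p. ennreal (w p)) \<Otimes>\<^sub>M internal_measure \<sigma>) g v"
proof -
  define h where "h z = indicator (UNIV \<times> {0<..}) z * (snd z powr \<sigma> * w (fst z))" for z :: "(real ^ 3) \<times> real"
  have S: "UNIV \<times> {0<..} \<in> sets (borel :: ((real ^ 3) \<times> real) measure)"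
    by (intro borel_open open_Times) auto
  note [measurable] = S
  have [measurable]: "h \<in> borel_measurable borel"
    unfolding h_def[abs_def] by measurable
  have h: "0 \<le> h z" for z by (simp add: h_def w)
  have "has_bochner_integral phase_measure (\<lambda>(p, I). (state_density \<sigma> I * w p) *\<^sub>R g (p, I)) v
      \<longleftrightarrow> has_bochner_integral lebesgue (\<lambda>z. indicator (UNIV \<times> {0<..}) z *\<^sub>R
            (case z of (p, I) \<Rightarrow> (state_density \<sigma> I * w p) *\<^sub>R g (p, I))) v"
    unfolding phase_measure_def
    by (rule has_bochner_integral_restrict_space) (use S in simp)
  also have "(\<lambda>z. indicator (UNIV \<times> {0<..}) z *\<^sub>R
            (case z of (p, I) \<Rightarrow> (state_density \<sigma> I * w p) *\<^sub>R g (p, I))) = (\<lambda>z. h z *\<^sub>R g z)"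
    by (auto simp: fun_eq_iff h_def state_density_def)
  also have "has_bochner_integral lebesgue (\<lambda>z. h z *\<^sub>R g z) v
      \<longleftrightarrow> has_bochner_integral lborel (\<lambda>z. h z *\<^sub>R g z) v"
    by (simp add: has_bochner_integral_iff integrable_completion integral_completion)
  also have "\<dots> \<longleftrightarrow> has_bochner_integral (density lborel (\<lambda>z. ennreal (h z))) g v"
    by (simp add: has_bochner_integral_iff integrable_density integral_density h)
  also have "density lborel (\<lambda>z. ennreal (h z))
      = density lborel (\<lambda>p. ennreal (w p)) \<Otimes>\<^sub>M internal_measure \<sigma>"
    unfolding h_def by (rule pair_internal_measure_eq[symmetric]) (use w in auto)
  finally show ?thesis .
qed

text \<open>
  A symmetry of the momentum measure acts on the phase space by leaving the internal energy alone.
\<close>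

lemma distr_pair_internal_measure:
  assumes [measurable]: "T \<in> borel \<rightarrow>\<^sub>M borel" and T: "distr D borel T = D"
    and [measurable_cong]: "sets D = sets (borel :: (real ^ 3) measure)"
  shows "distr (D \<Otimes>\<^sub>M internal_measure \<sigma>) borel (\<lambda>(p, I). (T p, I)) = D \<Otimes>\<^sub>M internal_measure \<sigma>"
proof -
  have id: "distr (internal_measure \<sigma>) borel (\<lambda>I. I) = internal_measure \<sigma>"
    by (rule distr_id2) simp
  have "distr D borel T \<Otimes>\<^sub>M distr (internal_measure \<sigma>) borel (\<lambda>I. I)
      = distr (D \<Otimes>\<^sub>M internal_measure \<sigma>) (borel \<Otimes>\<^sub>M borel) (\<lambda>(p, I). (T p, I))"
    by (rule pair_measure_distr) (simp_all add: id sigma_finite_internal_measure measurable_ident_sets)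
  then show ?thesis by (simp add: T id borel_prod)
qed

lemma has_bochner_integral_pair_internal_measure_comp:
  fixes g :: "(real ^ 3) \<times> real \<Rightarrow> 'b :: {banach, second_countable_topology}"
  assumes [measurable]: "T \<in> borel \<rightarrow>\<^sub>M borel" and T: "distr D borel T = D"
    and D [measurable_cong]: "sets D = sets (borel :: (real ^ 3) measure)"
    and [measurable]: "g \<in> borel_measurable borel"
    and g: "has_bochner_integral (D \<Otimes>\<^sub>M internal_measure \<sigma>) g v"
  shows "has_bochner_integral (D \<Otimes>\<^sub>M internal_measure \<sigma>) (\<lambda>(p, I). g (T p, I)) v"
proof -
  have [measurable]: "(\<lambda>(p, I). (T p, I)) \<in> D \<Otimes>\<^sub>M internal_measure \<sigma> \<rightarrow>\<^sub>M borel"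
    unfolding borel_prod[symmetric] by measurable
  show ?thesis
    using g distr_pair_internal_measure[OF assms(1,2,3), of \<sigma>]
      integrable_distr_eq[of "\<lambda>(p, I). (T p, I)" "D \<Otimes>\<^sub>M internal_measure \<sigma>" borel g]
      integral_distr[of "\<lambda>(p, I). (T p, I)" "D \<Otimes>\<^sub>M internal_measure \<sigma>" borel g]
    by (simp add: has_bochner_integral_iff case_prod_beta')
qed

lemma nn_integral_exp_abs_finite:
  assumes "0 < k"
  shows "(\<integral>\<^sup>+(x::real). ennreal (exp (- (k * \<bar>x\<bar>))) \<partial>lborel) < \<infinity>"
proof -
  have half: "(\<integral>\<^sup>+x. ennreal (exp (- k * x)) * indicator {0..} x \<partial>lborel) = ennreal (exp (- k * 0) / k)"
    by (rule nn_integral_has_integral_lebesgue'[OF _ has_integral_exp_minus_to_infinity[OF assms]]) simp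
  have "(\<integral>\<^sup>+x. ennreal (exp (- (k * \<bar>x\<bar>))) \<partial>lborel)
      \<le> (\<integral>\<^sup>+x. ennreal (exp (- k * x)) * indicator {0..} x
            + ennreal (exp (- k * (- x))) * indicator {0..} (- x) \<partial>lborel)"
    by (intro nn_integral_mono) (auto simp: indicator_def)
  also have "\<dots> = (\<integral>\<^sup>+x. ennreal (exp (- k * x)) * indicator {0..} x \<partial>lborel)
      + (\<integral>\<^sup>+x. ennreal (exp (- k * (- x))) * indicator {0..} (- x) \<partial>lborel)"
    by (rule nn_integral_add) auto
  also have "(\<integral>\<^sup>+x. ennreal (exp (- k * (- x))) * indicator {0..} (- x) \<partial>lborel)
      = (\<integral>\<^sup>+x. ennreal (exp (- k * x)) * indicator {0..} x \<partial>distr lborel borel uminus)"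
    by (rule nn_integral_distr[symmetric]) auto
  also have "distr lborel borel uminus = (lborel :: real measure)" by (rule lborel_distr_uminus)
  finally have "(\<integral>\<^sup>+x. ennreal (exp (- (k * \<bar>x\<bar>))) \<partial>lborel)
      \<le> ennreal (exp (- k * 0) / k) + ennreal (exp (- k * 0) / k)"
    unfolding half .
  also have "\<dots> < \<infinity>" by simp
  finally show ?thesis .
qed

text \<open>
  The norm dominates the average of the absolute values of the coordinates, which bounds the integrand by a product of
  functions of one coordinate each.
\<close>

lemma nn_integral_exp_norm_finite:
  assumes "0 < k"
  shows "(\<integral>\<^sup>+(p::'a::euclidean_space). ennreal (exp (- (k * norm p))) \<partial>lborel) < \<infinity>"
proof -
  define j where "j = k / real DIM('a)"
  have j: "0 < j" using assms by (simp add: j_def)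
  have "(\<integral>\<^sup>+(p::'a). ennreal (exp (- (k * norm p))) \<partial>lborel)
      \<le> (\<integral>\<^sup>+(p::'a). (\<Prod>b\<in>Basis. ennreal (exp (- (j * \<bar>inner p b\<bar>)))) \<partial>lborel)"
  proof (rule nn_integral_mono)
    fix p :: 'a
    have "(\<Sum>b\<in>Basis. j * \<bar>inner p b\<bar>) \<le> (\<Sum>b\<in>(Basis :: 'a set). j * norm p)"
      using j by (intro sum_mono mult_left_mono Basis_le_norm) auto
    also have "\<dots> = k * norm p" by (simp add: j_def)
    finally have "exp (- (k * norm p)) \<le> exp (- (\<Sum>b\<in>Basis. j * \<bar>inner p b\<bar>))" by simp
    also have "\<dots> = (\<Prod>b\<in>Basis. exp (- (j * \<bar>inner p b\<bar>)))"
      by (simp add: sum_negf[symmetric] exp_sum)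
    finally show "ennreal (exp (- (k * norm p))) \<le> (\<Prod>b\<in>Basis. ennreal (exp (- (j * \<bar>inner p b\<bar>))))"
      by (simp add: prod_ennreal ennreal_leI)
  qed
  also have "\<dots> = (\<Prod>b\<in>(Basis :: 'a set). \<integral>\<^sup>+x. ennreal (exp (- (j * \<bar>x\<bar>))) \<partial>lborel)"
    by (rule nn_integral_lborel_prod) auto
  also have "\<dots> < \<infinity>"
    using nn_integral_exp_abs_finite[OF j] by (simp add: power_less_top_ennreal)
  finally show ?thesis .
qed

text \<open>
  This is the Gamma integral, which converges at zero because \<open>\<sigma> > -1\<close>.
\<close>

lemma nn_integral_internal_measure_exp_finite:
  assumes "0 < k" "-1 < \<sigma>"
  shows "(\<integral>\<^sup>+I. ennreal (exp (- (k * I))) \<partial>internal_measure \<sigma>) < \<infinity>"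
proof -
  let ?f = "\<lambda>t. complex_of_real t powr (complex_of_real (\<sigma> + 1) - 1) / of_real (exp (k * t))"
  have "?f absolutely_integrable_on {0<..}"
    using assms by (intro absolutely_integrable_Gamma_integral) auto
  then have "(\<lambda>t. norm (?f t)) integrable_on {0<..}"
    by (simp add: absolutely_integrable_on_def)
  moreover have "norm (?f t) = t powr \<sigma> * exp (- (k * t))" if "t \<in> {0<..}" for t
    using that by (simp add: norm_divide norm_powr_real_powr exp_minus divide_inverse norm_mult norm_inverse)
  ultimately have "(\<lambda>t. t powr \<sigma> * exp (- (k * t))) integrable_on {0<..}"
    using integrable_cong[of "{0<..}" "\<lambda>t. norm (?f t)" "\<lambda>t. t powr \<sigma> * exp (- (k * t))"] by blast
  then obtain J where "((\<lambda>t. t powr \<sigma> * exp (- (k * t))) has_integral J) {0<..}" by blast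
  then have "(\<integral>\<^sup>+t. ennreal (t powr \<sigma> * exp (- (k * t))) * indicator {0<..} t \<partial>lborel) = ennreal J"
    by (intro nn_integral_has_integral_lebesgue') auto
  moreover have "(\<integral>\<^sup>+I. ennreal (exp (- (k * I))) \<partial>internal_measure \<sigma>)
      = (\<integral>\<^sup>+t. ennreal (t powr \<sigma> * exp (- (k * t))) * indicator {0<..} t \<partial>lborel)"
    unfolding internal_measure_def
    by (subst nn_integral_density) (auto intro!: nn_integral_cong simp: indicator_def ennreal_mult)
  ultimately show ?thesis by simp
qed

lemma emeasure_open_not_zero:
  fixes A :: "'a::euclidean_space set"
  assumes "open A" "A \<noteq> {}"
  shows "emeasure lborel A \<noteq> 0"
  using assms open_not_negligible[OF assms]
  by (auto simp: negligible_iff_null_sets null_sets_completion_iff null_sets_def)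

lemma emeasure_internal_measure_open_not_zero:
  assumes "open B" "x \<in> B" "0 < x"
  shows "emeasure (internal_measure \<sigma>) B \<noteq> 0"
proof
  have [measurable]: "B \<in> sets borel" using assms by simp
  assume "emeasure (internal_measure \<sigma>) B = 0"
  then have "AE t in lborel. ennreal (indicator {0<..} t * t powr \<sigma>) * indicator B t = 0"
    unfolding internal_measure_def by (simp add: emeasure_density nn_integral_0_iff_AE)
  then have "AE t in lborel. \<not> t \<in> B \<inter> {0<..}"
    by eventually_elim (auto simp: indicator_def)
  then have "emeasure lborel (B \<inter> {0<..}) = 0"
    by (subst (asm) AE_iff_measurable[where N="B \<inter> {0<..}"]) auto
  moreover have "open (B \<inter> {0<..})" "x \<in> B \<inter> {0<..}" using assms by auto
  ultimately show False using emeasure_open_not_zero[of "B \<inter> {0<..}"] by blast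
qed

text \<open>
  The energy variable \<open>(1 + I / (m c\<^sup>2)) p\<^sup>0\<close>: in these terms the integrand of \<open>juttner_M\<close> is
  \<open>exp (- k * X)\<close> with \<open>k = \<gamma> / (m c)\<close>, and that of \<open>juttner_M_tilde\<close> is \<open>exp (- k * X) / X\<close>.
\<close>

definition total_energy :: "real \<Rightarrow> real \<Rightarrow> (real ^ 3) \<times> real \<Rightarrow> real" where
  "total_energy m c = (\<lambda>(p, I). (1 + I / (m * c\<^sup>2)) * energy0 m c p)"

lemma continuous_total_energy: "continuous_on A (total_energy m c)"
  unfolding total_energy_def case_prod_beta' divide_inverse
  by (intro continuous_intros)

lemma borel_measurable_total_energy [measurable]: "total_energy m c \<in> borel_measurable borel"
  by (intro borel_measurable_continuous_onI continuous_total_energy)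

lemma AE_internal_energy_pos:
  "AE z in (lborel :: (real ^ 3) measure) \<Otimes>\<^sub>M internal_measure \<sigma>. 0 < snd z"
proof -
  interpret pair_sigma_finite "lborel :: (real ^ 3) measure" "internal_measure \<sigma>"
    by (intro pair_sigma_finite.intro sigma_finite_lborel sigma_finite_internal_measure)
  have "AE I in internal_measure \<sigma>. 0 < I"
    unfolding internal_measure_def by (subst AE_density) (auto simp: indicator_def)
  then have "AE p in (lborel :: (real ^ 3) measure). AE I in internal_measure \<sigma>. 0 < snd (p, I)" by simp
  moreover have "{z \<in> space ((lborel :: (real ^ 3) measure) \<Otimes>\<^sub>M internal_measure \<sigma>). 0 < snd z}
      = UNIV \<times> {0<..}"
    by (auto simp: space_pair_measure)
  ultimately show ?thesis by (intro AE_pair_measure) auto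
qed

text \<open>
  Integrability follows from \<open>X \<ge> norm p + I / c\<close>, which decouples momentum and internal energy. The least
  energy \<open>m c\<close> is approached near \<open>(0, 0)\<close>, where the measure charges every neighbourhood.
\<close>

lemma gibbs_family_total_energy:
  assumes mc: "0 < m" "0 < c" and \<sigma>: "-1 < \<sigma>"
  shows "gibbs_family (lborel \<Otimes>\<^sub>M internal_measure \<sigma>) (total_energy m c) (m * c)"
proof -
  interpret E: sigma_finite_measure "internal_measure \<sigma>" by (rule sigma_finite_internal_measure)
  let ?\<nu> = "lborel \<Otimes>\<^sub>M internal_measure \<sigma> :: ((real ^ 3) \<times> real) measure"
  have [measurable]: "fst \<in> borel_measurable ?\<nu>" "snd \<in> borel_measurable ?\<nu>"
    using measurable_fst[of lborel "internal_measure \<sigma>"] measurable_snd[of lborel "internal_measure \<sigma>"]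
    by (simp_all add: measurable_def)
  have sets_nu [measurable_cong]: "sets ?\<nu> = sets borel"
    unfolding borel_prod[symmetric] by (intro sets_pair_measure_cong) auto
  have I: "AE z in ?\<nu>. 0 < snd z"
    by (rule AE_internal_energy_pos)
  have ge: "norm p + I / c \<le> total_energy m c (p, I)" if "0 < I" for p I
  proof -
    have "norm p + I / c \<le> energy0 m c p + I / (m * c\<^sup>2) * (m * c)"
      using mc energy0_ge_norm[of p m c] by (simp add: power2_eq_square)
    also have "\<dots> \<le> energy0 m c p + I / (m * c\<^sup>2) * energy0 m c p"
      using that mc energy0_ge_mass[of m c p] by (intro add_left_mono mult_left_mono) auto
    finally show ?thesis by (simp add: total_energy_def algebra_simps)
  qed
  show ?thesis
  proof
    show "total_energy m c \<in> borel_measurable ?\<nu>" by measurable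
    show "0 < m * c" using mc by simp
    show "AE z in ?\<nu>. m * c \<le> total_energy m c z"
      using I
    proof eventually_elim
      case (elim z)
      have "1 * (m * c) \<le> (1 + snd z / (m * c\<^sup>2)) * energy0 m c (fst z)"
        using elim mc energy0_ge_mass[of m c "fst z"] by (intro mult_mono) auto
      then show ?case by (simp add: total_energy_def case_prod_beta')
    qed
  next
    fix k :: real assume k: "0 < k"
    show "integrable ?\<nu> (\<lambda>z. exp (- (k * total_energy m c z)))"
    proof (rule integrableI_bounded)
      have "(\<integral>\<^sup>+z. ennreal (norm (exp (- (k * total_energy m c z)))) \<partial>?\<nu>)
          \<le> (\<integral>\<^sup>+z. ennreal (exp (- (k * norm (fst z)))) * ennreal (exp (- (k / c * snd z))) \<partial>?\<nu>)"
      proof (rule nn_integral_mono_AE)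
        show "AE z in ?\<nu>. ennreal (norm (exp (- (k * total_energy m c z))))
            \<le> ennreal (exp (- (k * norm (fst z)))) * ennreal (exp (- (k / c * snd z)))"
          using I
        proof eventually_elim
          case (elim z)
          have "k * (norm (fst z) + snd z / c) \<le> k * total_energy m c z"
            using ge[OF elim, of "fst z"] k by (intro mult_left_mono) auto
          then show ?case
            by (auto simp: algebra_simps intro!: ennreal_leI simp flip: ennreal_mult exp_add)
        qed
      qed
      also have "\<dots> = (\<integral>\<^sup>+p. (\<integral>\<^sup>+I. ennreal (exp (- (k * norm p))) * ennreal (exp (- (k / c * I)))
          \<partial>internal_measure \<sigma>) \<partial>(lborel :: (real ^ 3) measure))"
        by (subst E.nn_integral_fst[symmetric]) auto
      also have "\<dots> = (\<integral>\<^sup>+p. ennreal (exp (- (k * norm p))) \<partial>(lborel :: (real ^ 3) measure))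
          * (\<integral>\<^sup>+I. ennreal (exp (- (k / c * I))) \<partial>internal_measure \<sigma>)"
        by (simp add: nn_integral_cmult nn_integral_multc)
      also have "\<dots> < \<infinity>"
        using nn_integral_exp_norm_finite[OF k, where 'a="real ^ 3"]
          nn_integral_internal_measure_exp_finite[of "k / c" \<sigma>] k mc \<sigma>
        by (simp add: ennreal_mult_less_top)
      finally show "(\<integral>\<^sup>+z. ennreal (norm (exp (- (k * total_energy m c z)))) \<partial>?\<nu>) < \<infinity>" .
    qed measurable
  next
    have "emeasure ?\<nu> (UNIV \<times> UNIV) = emeasure lborel (UNIV :: (real ^ 3) set) * emeasure (internal_measure \<sigma>) UNIV"
      by (rule E.emeasure_pair_measure_Times) auto
    also have "\<dots> = \<infinity>"
      using emeasure_internal_measure_open_not_zero[of UNIV 1 \<sigma>]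
      by (simp add: ennreal_top_mult)
    finally show "emeasure ?\<nu> (space ?\<nu>) = \<infinity>" by (simp add: space_pair_measure)
  next
    fix b assume b: "m * c < b"
    let ?S = "{z. total_energy m c z < b}"
    have "open ?S" by (intro open_Collect_less continuous_total_energy continuous_on_const)
    moreover have "(0, 0) \<in> ?S" using b mc by (simp add: total_energy_def energy0_def)
    ultimately obtain A B where AB: "open A" "open B" "(0 :: real ^ 3, 0 :: real) \<in> A \<times> B" "A \<times> B \<subseteq> ?S"
      by (rule open_prod_elim)
    obtain e where e: "0 < e" "ball 0 e \<subseteq> B" using openE[OF AB(2), of 0] AB(3) by blast
    then have "e / 2 \<in> B" by (auto simp: subset_eq)
    have "A \<noteq> {}" using AB(3) by auto
    have "emeasure lborel A * emeasure (internal_measure \<sigma>) B \<noteq> 0"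
      using emeasure_open_not_zero[OF AB(1) \<open>A \<noteq> {}\<close>] e(1)
        emeasure_internal_measure_open_not_zero[OF AB(2) \<open>e / 2 \<in> B\<close>, of \<sigma>] by simp
    moreover have "emeasure lborel A * emeasure (internal_measure \<sigma>) B = emeasure ?\<nu> (A \<times> B)"
      using AB by (intro E.emeasure_pair_measure_Times[symmetric]) auto
    moreover have "emeasure ?\<nu> (A \<times> B) \<le> emeasure ?\<nu> ?S"
      by (rule emeasure_mono[OF AB(4)], unfold sets_nu) (rule borel_open[OF \<open>open ?S\<close>])
    ultimately show "emeasure ?\<nu> {z \<in> space ?\<nu>. total_energy m c z < b} \<noteq> 0"
      by (auto simp: space_pair_measure)
  qed
qed

section \<open>Moments of the Juettner distribution\<close>

lemma four_velocity_eq: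
  assumes "0 < c"
  shows "four_velocity c U = c *\<^sub>R (lorentz_factor (U /\<^sub>R c), U /\<^sub>R c)"
proof -
  have "c * lorentz_factor (U /\<^sub>R c) = sqrt (c\<^sup>2 * (1 + (norm U / c)\<^sup>2))"
    using assms by (simp add: lorentz_factor_def real_sqrt_mult divide_inverse mult.commute)
  also have "c\<^sup>2 * (1 + (norm U / c)\<^sup>2) = c\<^sup>2 + (norm U)\<^sup>2"
    using assms by (simp add: field_simps)
  finally show ?thesis using assms by (simp add: four_velocity_def)
qed

text \<open>
  The product with the four-velocity is the energy seen by a comoving observer. Therefore the exponent of the Juettner
  distribution depends only on the boosted momentum.
\<close>

lemma lorentz_product_four_velocity:
  assumes "0 < m" "0 < c"
  shows "lorentz_product (four_velocity c U) (four_momentum m c p) = c * energy0 m c (boost m c (U /\<^sub>R c) p)"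
proof -
  have "lorentz_product (four_velocity c U) (four_momentum m c p)
      = c * (lorentz_factor (U /\<^sub>R c) * energy0 m c p - inner (U /\<^sub>R c) p)"
    using assms unfolding four_velocity_eq[OF assms(2)]
    by (simp add: lorentz_product_def four_momentum_def inner_vec_def[symmetric] right_diff_distrib)
       (simp add: inner_vec_def)
  then show ?thesis using assms by (simp add: energy0_boost)
qed

lemma juttner_eq:
  assumes "0 < m" "0 < c"
  shows "juttner m c \<sigma> n (four_velocity c U) \<gamma> (p, I) =
    n / juttner_M m c \<sigma> \<gamma> * exp (- (\<gamma> / (m * c) * total_energy m c (boost m c (U /\<^sub>R c) p, I)))"
  using assms
  by (simp add: juttner_def lorentz_product_four_velocity total_energy_def power2_eq_square mult_ac)

abbreviation lebesgue_internal :: "real \<Rightarrow> ((real ^ 3) \<times> real) measure" where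
  "lebesgue_internal \<sigma> \<equiv> lborel \<Otimes>\<^sub>M internal_measure \<sigma>"

abbreviation mass_shell_internal :: "real \<Rightarrow> real \<Rightarrow> real \<Rightarrow> ((real ^ 3) \<times> real) measure" where
  "mass_shell_internal m c \<sigma> \<equiv> mass_shell_measure m c \<Otimes>\<^sub>M internal_measure \<sigma>"

lemma has_bochner_integral_phase_measure_lebesgue_iff:
  fixes g :: "(real ^ 3) \<times> real \<Rightarrow> 'b :: {banach, second_countable_topology}"
  assumes "g \<in> borel_measurable borel"
  shows "has_bochner_integral phase_measure (\<lambda>(p, I). state_density \<sigma> I *\<^sub>R g (p, I)) v
    \<longleftrightarrow> has_bochner_integral (lebesgue_internal \<sigma>) g v"
  using has_bochner_integral_phase_measure_iff[of "\<lambda>_. 1" g \<sigma> v] assms by (simp add: density_1)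

lemma has_bochner_integral_phase_measure_mass_shell_iff:
  fixes g :: "(real ^ 3) \<times> real \<Rightarrow> 'b :: {banach, second_countable_topology}"
  assumes "g \<in> borel_measurable borel" "0 < m" "0 < c"
  shows "has_bochner_integral phase_measure (\<lambda>(p, I). (state_density \<sigma> I / energy0 m c p) *\<^sub>R g (p, I)) v
    \<longleftrightarrow> has_bochner_integral (mass_shell_internal m c \<sigma>) g v"
  using has_bochner_integral_phase_measure_iff[of "\<lambda>p. 1 / energy0 m c p" g \<sigma> v] assms
    energy0_pos[of m c]
  by (simp add: mass_shell_measure_def less_imp_le)

lemma has_bochner_integral_mass_shell_energy:
  assumes [measurable]: "g \<in> borel_measurable borel" and mc: "0 < m" "0 < c"
    and g: "has_bochner_integral (lebesgue_internal \<sigma>) g (v :: real)"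
  shows "has_bochner_integral (mass_shell_internal m c \<sigma>) (\<lambda>(p, I). energy0 m c p * g (p, I)) v"
proof -
  have [measurable]: "(\<lambda>(p, I). energy0 m c p * g (p, I)) \<in> borel_measurable borel"
    unfolding case_prod_beta' by measurable
  have "energy0 m c p \<noteq> 0" for p using energy0_pos[of m c p] mc by simp
  then show ?thesis
    using g
    by (subst has_bochner_integral_phase_measure_mass_shell_iff[symmetric])
       (simp_all add: mc has_bochner_integral_phase_measure_lebesgue_iff[symmetric])
qed

lemma juttner_M_eq:
  assumes "0 < m" "0 < c" "-1 < \<sigma>" "0 < \<gamma>"
  shows "has_bochner_integral (lebesgue_internal \<sigma>) (\<lambda>z. exp (- (\<gamma> / (m * c) * total_energy m c z)))
      (juttner_M m c \<sigma> \<gamma>)" (is "has_bochner_integral _ ?g _")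
    and "gibbs_family.Z (lebesgue_internal \<sigma>) (total_energy m c) (\<gamma> / (m * c)) = juttner_M m c \<sigma> \<gamma>"
proof -
  interpret gibbs_family "lebesgue_internal \<sigma>" "total_energy m c" "m * c"
    by (rule gibbs_family_total_energy) fact+
  have 1: "has_bochner_integral (lebesgue_internal \<sigma>) ?g (Z (\<gamma> / (m * c)))"
    using exp_integrable[of "\<gamma> / (m * c)"] assms by (simp add: has_bochner_integral_iff Z_def)
  then have "has_bochner_integral phase_measure (\<lambda>(p, I). state_density \<sigma> I *\<^sub>R ?g (p, I)) (Z (\<gamma> / (m * c)))"
    by (subst has_bochner_integral_phase_measure_lebesgue_iff) auto
  then show "Z (\<gamma> / (m * c)) = juttner_M m c \<sigma> \<gamma>"
    by (simp add: has_bochner_integral_iff juttner_M_def total_energy_def mult_ac)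
  with 1 show "has_bochner_integral (lebesgue_internal \<sigma>) ?g (juttner_M m c \<sigma> \<gamma>)" by simp
qed

lemma juttner_M_tilde_eq:
  assumes "0 < m" "0 < c" "-1 < \<sigma>" "0 < \<gamma>"
  shows "has_bochner_integral (lebesgue_internal \<sigma>)
      (\<lambda>z. inverse (total_energy m c z) * exp (- (\<gamma> / (m * c) * total_energy m c z)))
      (juttner_M_tilde m c \<sigma> \<gamma>)" (is "has_bochner_integral _ ?g _")
    and "gibbs_family.W (lebesgue_internal \<sigma>) (total_energy m c) (\<gamma> / (m * c)) = juttner_M_tilde m c \<sigma> \<gamma>"
proof -
  interpret gibbs_family "lebesgue_internal \<sigma>" "total_energy m c" "m * c"
    by (rule gibbs_family_total_energy) fact+
  have 1: "has_bochner_integral (lebesgue_internal \<sigma>) ?g (W (\<gamma> / (m * c)))"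
    using inverse_exp_integrable[of "\<gamma> / (m * c)"] assms by (simp add: has_bochner_integral_iff W_def)
  then have "has_bochner_integral phase_measure (\<lambda>(p, I). state_density \<sigma> I *\<^sub>R ?g (p, I)) (W (\<gamma> / (m * c)))"
    by (subst has_bochner_integral_phase_measure_lebesgue_iff) auto
  then show "W (\<gamma> / (m * c)) = juttner_M_tilde m c \<sigma> \<gamma>"
    by (simp add: has_bochner_integral_iff juttner_M_tilde_def total_energy_def mult_ac divide_inverse)
  with 1 show "has_bochner_integral (lebesgue_internal \<sigma>) ?g (juttner_M_tilde m c \<sigma> \<gamma>)" by simp
qed

lemma juttner_M_pos:
  assumes "0 < m" "0 < c" "-1 < \<sigma>" "0 < \<gamma>"
  shows "0 < juttner_M m c \<sigma> \<gamma>"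
proof -
  interpret gibbs_family "lebesgue_internal \<sigma>" "total_energy m c" "m * c"
    by (rule gibbs_family_total_energy) fact+
  show ?thesis using Z_pos[of "\<gamma> / (m * c)"] juttner_M_eq(2)[OF assms] assms by simp
qed

lemma juttner_M_tilde_ratio_unique_root:
  assumes "0 < m" "0 < c" "-1 < \<sigma>" and y: "0 < y" "y < inverse (m * c)"
  shows "\<exists>!\<gamma>. 0 < \<gamma> \<and> juttner_M_tilde m c \<sigma> \<gamma> / juttner_M m c \<sigma> \<gamma> = y"
proof -
  interpret gibbs_family "lebesgue_internal \<sigma>" "total_energy m c" "m * c"
    by (rule gibbs_family_total_energy) fact+
  have iff: "(0 < \<gamma> \<and> juttner_M_tilde m c \<sigma> \<gamma> / juttner_M m c \<sigma> \<gamma> = y)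
      \<longleftrightarrow> (0 < \<gamma> / (m * c) \<and> W (\<gamma> / (m * c)) / Z (\<gamma> / (m * c)) = y)" for \<gamma>
  proof -
    have "0 < m * c" using assms(1,2) by simp
    then have "0 < \<gamma> / (m * c) \<longleftrightarrow> 0 < \<gamma>" unfolding zero_less_divide_iff by linarith
    then show ?thesis
      using juttner_M_eq(2)[OF assms(1-3), of \<gamma>] juttner_M_tilde_eq(2)[OF assms(1-3), of \<gamma>] by auto
  qed
  obtain k where k: "0 < k" "W k / Z k = y" and uniq: "\<And>l. 0 < l \<and> W l / Z l = y \<Longrightarrow> l = k"
    using ratio_unique_root[OF y] by blast
  show ?thesis unfolding iff
  proof (rule ex1I[of _ "k * (m * c)"])
    show "0 < k * (m * c) / (m * c) \<and> W (k * (m * c) / (m * c)) / Z (k * (m * c) / (m * c)) = y"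
      using k assms by simp
    fix \<gamma> assume "0 < \<gamma> / (m * c) \<and> W (\<gamma> / (m * c)) / Z (\<gamma> / (m * c)) = y"
    then have "\<gamma> / (m * c) = k" by (rule uniq)
    then show "\<gamma> = k * (m * c)" using assms by (auto simp: field_simps)
  qed
qed

text \<open>
  The linear transformation of four-vectors that undoes the boost. Its linearity lets it be pulled out
  of the flux integral.
\<close>

definition inverse_boost4 :: "real ^ 3 \<Rightarrow> four_vector \<Rightarrow> four_vector" where
  "inverse_boost4 u = (\<lambda>(t, q). (lorentz_factor u * t + inner u q,
     q + (inner u q / (1 + lorentz_factor u) + t) *\<^sub>R u))"

lemma bounded_linear_inverse_boost4: "bounded_linear (inverse_boost4 u)"
  unfolding linear_conv_bounded_linear[symmetric]
  by (rule linearI) (auto simp: inverse_boost4_def inner_add_right algebra_simps add_divide_distrib)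

lemma inverse_boost4_four_momentum_boost:
  assumes "m * c \<noteq> 0"
  shows "inverse_boost4 u (four_momentum m c (boost m c u p)) = four_momentum m c p"
proof -
  have "energy0 m c (boost m c (- u) (boost m c u p))
      = lorentz_factor u * energy0 m c (boost m c u p) + inner u (boost m c u p)"
    by (subst energy0_boost[OF assms]) simp
  then have 1: "lorentz_factor u * energy0 m c (boost m c u p) + inner u (boost m c u p) = energy0 m c p"
    by (simp add: boost_boost_uminus[OF assms])
  have "boost m c (- u) q = q + (inner u q / (1 + lorentz_factor u) + energy0 m c q) *\<^sub>R u" for q
    by (simp add: boost_def algebra_simps)
  from this[of "boost m c u p"]
  have 2: "boost m c u p + (inner u (boost m c u p) / (1 + lorentz_factor u) + energy0 m c (boost m c u p)) *\<^sub>R u = p"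
    by (simp add: boost_boost_uminus[OF assms])
  show ?thesis using 1 2 by (simp add: inverse_boost4_def four_momentum_def)
qed

text \<open>
  In the rest frame the flux has no spatial part, since the spatial integrand changes sign under \<open>p \<mapsto> -p\<close>.
\<close>

lemma has_bochner_integral_even_four_momentum:
  assumes mc: "0 < m" "0 < c" and [measurable]: "h \<in> borel_measurable borel"
    and even: "\<And>p I. h (- p, I) = h (p, I)"
    and h: "has_bochner_integral (lebesgue_internal \<sigma>) h (v :: real)"
  shows "has_bochner_integral (mass_shell_internal m c \<sigma>) (\<lambda>(p, I). h (p, I) *\<^sub>R four_momentum m c p) (v, 0)"
proof -
  let ?N = "mass_shell_internal m c \<sigma>"
  let ?g = "\<lambda>z. h z *\<^sub>R fst z"
  have [measurable_cong]: "sets ?N = sets borel"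
    unfolding borel_prod[symmetric] by (intro sets_pair_measure_cong) auto
  have time: "has_bochner_integral ?N (\<lambda>(p, I). energy0 m c p * h (p, I)) v"
    by (rule has_bochner_integral_mass_shell_energy) (use mc h in auto)
  have int: "integrable ?N ?g"
  proof (rule Bochner_Integration.integrable_bound)
    show "integrable ?N (\<lambda>(p, I). energy0 m c p * h (p, I))"
      using time by (simp add: has_bochner_integral_iff)
    show "?g \<in> borel_measurable ?N" by measurable
    have "norm (?g z) \<le> norm (case z of (p, I) \<Rightarrow> energy0 m c p * h (p, I))" for z
      using energy0_ge_norm[of "fst z" m c] energy0_pos[of m c "fst z"] mc
      by (auto simp: case_prod_beta' abs_mult mult.commute[of "energy0 m c _"] intro!: mult_left_mono)
    then show "AE z in ?N. norm (?g z) \<le> norm (case z of (p, I) \<Rightarrow> energy0 m c p * h (p, I))" by simp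
  qed
  define x where "x = integral\<^sup>L ?N ?g"
  have x: "has_bochner_integral ?N ?g x" using int by (simp add: has_bochner_integral_iff x_def)
  have "has_bochner_integral ?N (\<lambda>(p, I). ?g (- p, I)) x"
    by (rule has_bochner_integral_pair_internal_measure_comp)
       (use x distr_uminus_mass_shell_measure in auto)
  then have "has_bochner_integral ?N (\<lambda>z. - ?g z) x" by (simp add: even case_prod_beta')
  moreover have "has_bochner_integral ?N (\<lambda>z. - ?g z) (- x)"
    using x by (rule has_bochner_integral_minus)
  ultimately have "x = - x" by (rule has_bochner_integral_eq)
  then have "x + x = - x + x" by (rule arg_cong)
  then have "x = 0" by (simp flip: scaleR_2)
  with x have space: "has_bochner_integral ?N ?g 0" by simp
  have bl: "bounded_linear (\<lambda>t::real. (t, 0 :: real ^ 3))" "bounded_linear (\<lambda>q :: real ^ 3. (0 :: real, q))"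
    unfolding linear_conv_bounded_linear[symmetric] by (auto intro!: linearI)
  have "has_bochner_integral ?N (\<lambda>z. (case z of (p, I) \<Rightarrow> energy0 m c p * h (p, I), 0) + (0, ?g z)) ((v, 0) + (0, 0))"
    by (intro has_bochner_integral_add has_bochner_integral_bounded_linear[OF bl(1) time]
        has_bochner_integral_bounded_linear[OF bl(2) space])
  moreover have "(\<lambda>z. (case z of (p, I) \<Rightarrow> energy0 m c p * h (p, I), 0) + (0, ?g z))
      = (\<lambda>(p, I). h (p, I) *\<^sub>R four_momentum m c p)"
    by (auto simp: fun_eq_iff four_momentum_def mult.commute)
  ultimately show ?thesis by simp
qed

lemma borel_measurable_four_momentum [measurable]: "four_momentum m c \<in> borel_measurable borel"
  unfolding four_momentum_def[abs_def]
  by (intro borel_measurable_continuous_onI continuous_intros)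

text \<open>
  In the boosted coordinates \<open>q\<close> the distribution is the one at rest, whose flux is \<open>(n, 0)\<close> by the choice of the
  normalization \<open>juttner_M\<close>. The momentum \<open>p\<close> is the image of \<open>q\<close> under a fixed linear map, and the measure is invariant,
  so that the flux is the image of \<open>(n, 0)\<close> under this map.
\<close>

lemma has_bochner_integral_flux_juttner:
  assumes mc: "0 < m" "0 < c" and \<sigma>: "-1 < \<sigma>" and \<gamma>: "0 < \<gamma>"
  shows "has_bochner_integral phase_measure
    (flux_density m c \<sigma> (juttner m c \<sigma> n (four_velocity c U) \<gamma>)) ((n / c) *\<^sub>R four_velocity c U)"
proof -
  define u where "u = U /\<^sub>R c"
  define h where "h z = n / juttner_M m c \<sigma> \<gamma> * exp (- (\<gamma> / (m * c) * total_energy m c z))" for z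
  let ?N = "mass_shell_internal m c \<sigma>"
  have [measurable]: "h \<in> borel_measurable borel" unfolding h_def[abs_def] by measurable
  have J: "juttner m c \<sigma> n (four_velocity c U) \<gamma> (p, I) = h (boost m c u p, I)" for p I
    by (simp add: juttner_eq[OF mc] h_def u_def)
  have "has_bochner_integral (lebesgue_internal \<sigma>) h (n / juttner_M m c \<sigma> \<gamma> * juttner_M m c \<sigma> \<gamma>)"
    unfolding h_def by (intro has_bochner_integral_mult_right juttner_M_eq(1) assms)
  then have "has_bochner_integral (lebesgue_internal \<sigma>) h n"
    using juttner_M_pos[OF assms] by simp
  then have rest: "has_bochner_integral ?N (\<lambda>(p, I). h (p, I) *\<^sub>R four_momentum m c p) (n, 0)"
  proof (rule has_bochner_integral_even_four_momentum[OF mc, rotated 2])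
    show "h (- p, I) = h (p, I)" for p I by (simp add: h_def total_energy_def)
  qed simp
  define g where "g = (\<lambda>(p, I). inverse_boost4 u (h (p, I) *\<^sub>R four_momentum m c p))"
  have "has_bochner_integral ?N g (inverse_boost4 u (n, 0))"
    using has_bochner_integral_bounded_linear[OF bounded_linear_inverse_boost4[of u] rest]
    by (simp add: g_def case_prod_beta')
  moreover have [measurable]: "inverse_boost4 u \<in> borel_measurable borel"
    by (intro borel_measurable_continuous_onI linear_continuous_on bounded_linear_inverse_boost4)
  moreover have "g \<in> borel_measurable borel"
    unfolding g_def case_prod_beta' by measurable
  ultimately have "has_bochner_integral ?N (\<lambda>(p, I). g (boost m c u p, I)) (inverse_boost4 u (n, 0))"
    using mc by (intro has_bochner_integral_pair_internal_measure_comp distr_boost_mass_shell_measure) auto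
  also have "(\<lambda>(p, I). g (boost m c u p, I))
      = (\<lambda>(p, I). juttner m c \<sigma> n (four_velocity c U) \<gamma> (p, I) *\<^sub>R four_momentum m c p)"
    using mc by (auto simp: fun_eq_iff g_def J inverse_boost4_four_momentum_boost
      linear_simps(5)[OF bounded_linear_inverse_boost4])
  also have "inverse_boost4 u (n, 0) = (n / c) *\<^sub>R four_velocity c U"
    using mc by (simp add: inverse_boost4_def four_velocity_eq u_def divide_inverse mult.commute)
  finally have *: "has_bochner_integral ?N
      (\<lambda>(p, I). juttner m c \<sigma> n (four_velocity c U) \<gamma> (p, I) *\<^sub>R four_momentum m c p)
      ((n / c) *\<^sub>R four_velocity c U)" .
  have [measurable]: "(\<lambda>(p, I). juttner m c \<sigma> n (four_velocity c U) \<gamma> (p, I) *\<^sub>R four_momentum m c p)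
      \<in> borel_measurable borel"
  proof -
    have "(\<lambda>z :: (real ^ 3) \<times> real. (boost m c u (fst z), snd z)) \<in> borel \<rightarrow>\<^sub>M borel"
      by (subst (2) borel_prod[symmetric]) measurable
    then show ?thesis unfolding J case_prod_beta' by measurable
  qed
  have "flux_density m c \<sigma> (juttner m c \<sigma> n (four_velocity c U) \<gamma>) = (\<lambda>(p, I).
      (state_density \<sigma> I / energy0 m c p) *\<^sub>R
        (case (p, I) of (p, I) \<Rightarrow> juttner m c \<sigma> n (four_velocity c U) \<gamma> (p, I) *\<^sub>R four_momentum m c p))"
    by (auto simp: flux_density_def fun_eq_iff mult.commute)
  then show ?thesis
    by (simp only:) (subst has_bochner_integral_phase_measure_mass_shell_iff[OF _ mc], use * in simp_all)
qed

text \<open>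
  Apart from the distribution itself the integrand depends on \<open>I\<close> only, so that the invariance of \<open>dp / p\<^sup>0\<close> moves the
  integral to the rest frame.
\<close>

lemma has_bochner_integral_inverse_juttner:
  assumes mc: "0 < m" "0 < c" and \<sigma>: "-1 < \<sigma>" and \<gamma>: "0 < \<gamma>"
  shows "has_bochner_integral phase_measure
    (\<lambda>(p, I). juttner m c \<sigma> n (four_velocity c U) \<gamma> (p, I) * inverse (1 + I / (m * c\<^sup>2)) * state_density \<sigma> I / energy0 m c p)
    (n * (juttner_M_tilde m c \<sigma> \<gamma> / juttner_M m c \<sigma> \<gamma>))"
proof -
  define u where "u = U /\<^sub>R c"
  define h where "h z = n / juttner_M m c \<sigma> \<gamma> *
    (inverse (total_energy m c z) * exp (- (\<gamma> / (m * c) * total_energy m c z)))" for z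
  define g where "g = (\<lambda>(p, I). energy0 m c p * h (p, I))"
  let ?N = "mass_shell_internal m c \<sigma>"
  have [measurable]: "h \<in> borel_measurable borel" unfolding h_def[abs_def] by measurable
  then have [measurable]: "g \<in> borel_measurable borel" unfolding g_def case_prod_beta' by measurable
  have "has_bochner_integral (lebesgue_internal \<sigma>) h (n / juttner_M m c \<sigma> \<gamma> * juttner_M_tilde m c \<sigma> \<gamma>)"
    unfolding h_def by (intro has_bochner_integral_mult_right juttner_M_tilde_eq(1) assms)
  then have "has_bochner_integral ?N g (n / juttner_M m c \<sigma> \<gamma> * juttner_M_tilde m c \<sigma> \<gamma>)"
    unfolding g_def using mc by (intro has_bochner_integral_mass_shell_energy) auto
  then have *: "has_bochner_integral ?N (\<lambda>(p, I). g (boost m c u p, I))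
      (n / juttner_M m c \<sigma> \<gamma> * juttner_M_tilde m c \<sigma> \<gamma>)"
    using mc by (intro has_bochner_integral_pair_internal_measure_comp distr_boost_mass_shell_measure) auto
  have [measurable]: "(\<lambda>(p, I). g (boost m c u p, I)) \<in> borel_measurable borel"
  proof -
    have "(\<lambda>z :: (real ^ 3) \<times> real. (boost m c u (fst z), snd z)) \<in> borel \<rightarrow>\<^sub>M borel"
      by (subst (2) borel_prod[symmetric]) measurable
    then show ?thesis unfolding case_prod_beta' by measurable
  qed
  have J: "g (boost m c u p, I) = juttner m c \<sigma> n (four_velocity c U) \<gamma> (p, I) * inverse (1 + I / (m * c\<^sup>2))" for p I
  proof -
    have "energy0 m c (boost m c u p) \<noteq> 0" using energy0_pos[of m c "boost m c u p"] mc by simp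
    then show ?thesis
      by (simp add: juttner_eq[OF mc] g_def h_def u_def[symmetric]) (simp add: total_energy_def)
  qed
  have "(\<lambda>(p, I). juttner m c \<sigma> n (four_velocity c U) \<gamma> (p, I) * inverse (1 + I / (m * c\<^sup>2)) * state_density \<sigma> I / energy0 m c p)
      = (\<lambda>(p, I). (state_density \<sigma> I / energy0 m c p) *\<^sub>R (case (p, I) of (p, I) \<Rightarrow> g (boost m c u p, I)))"
    by (auto simp: fun_eq_iff J)
  moreover have "n / juttner_M m c \<sigma> \<gamma> * juttner_M_tilde m c \<sigma> \<gamma>
      = n * (juttner_M_tilde m c \<sigma> \<gamma> / juttner_M m c \<sigma> \<gamma>)" by simp
  ultimately show ?thesis
    using * by (simp only:) (subst has_bochner_integral_phase_measure_mass_shell_iff[OF _ mc], simp_all)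
qed

section \<open>Moments of a general distribution function\<close>

lemma space_phase_measure: "space phase_measure = UNIV \<times> {0<..}"
  by (simp add: phase_measure_def)

lemma borel_measurable_phase_measure:
  "g \<in> borel_measurable borel \<Longrightarrow> g \<in> borel_measurable phase_measure"
  unfolding phase_measure_def by (intro measurable_restrict_space1 measurable_completion) simp

lemma has_bochner_integral_iff_eq:
  "has_bochner_integral M g v \<Longrightarrow> has_bochner_integral M g w \<longleftrightarrow> v = w"
  using has_bochner_integral_eq by blast

definition flux :: "real \<Rightarrow> real \<Rightarrow> real \<Rightarrow> ((real ^ 3) \<times> real \<Rightarrow> real) \<Rightarrow> four_vector" where
  "flux m c \<sigma> f = integral\<^sup>L phase_measure (flux_density m c \<sigma> f)"

definition inverse_energy_moment :: "real \<Rightarrow> real \<Rightarrow> real \<Rightarrow> ((real ^ 3) \<times> real \<Rightarrow> real) \<Rightarrow> real" where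
  "inverse_energy_moment m c \<sigma> f = integral\<^sup>L phase_measure
     (\<lambda>(p, I). f (p, I) * inverse (1 + I / (m * c\<^sup>2)) * state_density \<sigma> I / energy0 m c p)"

text \<open>
  The hypotheses on a general distribution function. All moments that occur below are integrals against the
  non-negative weight \<open>f * \<phi> / p\<^sup>0\<close>, whose product with \<open>p\<^sup>0\<close> is integrable.
\<close>

locale distribution_function =
  fixes m c \<sigma> :: real and f :: "(real ^ 3) \<times> real \<Rightarrow> real"
  assumes m: "0 < m" and c: "0 < c" and \<sigma>: "-1 < \<sigma>"
    and f_meas [measurable]: "f \<in> borel_measurable phase_measure"
    and f_nonneg: "\<And>p I. 0 < I \<Longrightarrow> 0 \<le> f (p, I)"
    and f_nonzero: "\<not> (AE z in phase_measure. f z = 0)"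
    and flux_integrable: "integrable phase_measure (flux_density m c \<sigma> f)"
begin

definition flux_weight :: "(real ^ 3) \<times> real \<Rightarrow> real" where
  "flux_weight z = f z * state_density \<sigma> (snd z) / energy0 m c (fst z)"

lemma e_pos: "0 < energy0 m c p"
  using energy0_pos[of m c p] m c by simp

lemma flux_weight_nonneg: "z \<in> space phase_measure \<Longrightarrow> 0 \<le> flux_weight z"
  using f_nonneg e_pos by (auto simp: flux_weight_def space_phase_measure state_density_def less_imp_le)

lemma measurable_coordinates [measurable]:
  "fst \<in> borel_measurable phase_measure" "snd \<in> borel_measurable phase_measure"
  by (auto intro: borel_measurable_phase_measure)

lemma flux_weight_meas [measurable]: "flux_weight \<in> borel_measurable phase_measure"
  unfolding flux_weight_def[abs_def] by measurable

lemma flux_density_flux_weight: "flux_density m c \<sigma> f = (\<lambda>z. flux_weight z *\<^sub>R four_momentum m c (fst z))"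
  by (auto simp: flux_density_def flux_weight_def fun_eq_iff)

lemma has_flux: "has_bochner_integral phase_measure (\<lambda>z. flux_weight z *\<^sub>R four_momentum m c (fst z)) (flux m c \<sigma> f)"
  using flux_integrable by (simp add: has_bochner_integral_iff flux_def flux_density_flux_weight)

lemma has_time_flux: "has_bochner_integral phase_measure (\<lambda>z. flux_weight z * energy0 m c (fst z)) (fst (flux m c \<sigma> f))"
  using has_bochner_integral_bounded_linear[OF bounded_linear_fst has_flux]
  by (simp add: four_momentum_def)

lemma has_space_flux: "has_bochner_integral phase_measure (\<lambda>z. flux_weight z *\<^sub>R fst z) (snd (flux m c \<sigma> f))"
  using has_bochner_integral_bounded_linear[OF bounded_linear_snd has_flux]
  by (simp add: four_momentum_def)

lemma integrable_flux_weight_bounded: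
  assumes [measurable]: "w \<in> borel_measurable phase_measure"
    and w: "\<And>z. z \<in> space phase_measure \<Longrightarrow> \<bar>w z\<bar> \<le> energy0 m c (fst z) * C"
  shows "integrable phase_measure (\<lambda>z. flux_weight z * w z)"
proof (rule Bochner_Integration.integrable_bound)
  show "integrable phase_measure (\<lambda>z. C * (flux_weight z * energy0 m c (fst z)))"
    using has_time_flux by (simp add: has_bochner_integral_iff)
  show "AE z in phase_measure. norm (flux_weight z * w z) \<le> norm (C * (flux_weight z * energy0 m c (fst z)))"
  proof (rule AE_I2)
    fix z assume z: "z \<in> space phase_measure"
    have "flux_weight z * \<bar>w z\<bar> \<le> flux_weight z * (energy0 m c (fst z) * C)"
      using flux_weight_nonneg[OF z] w[OF z] by (rule mult_left_mono[rotated])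
    also have "\<dots> \<le> \<bar>C * (flux_weight z * energy0 m c (fst z))\<bar>" by (simp add: mult_ac)
    finally show "norm (flux_weight z * w z) \<le> norm (C * (flux_weight z * energy0 m c (fst z)))"
      using flux_weight_nonneg[OF z] by (simp add: abs_mult)
  qed
qed measurable

lemma integral_flux_weight_pos:
  assumes "integrable phase_measure (\<lambda>z. flux_weight z * w z)" and w: "\<And>z. z \<in> space phase_measure \<Longrightarrow> 0 < w z"
  shows "0 < (\<integral>z. flux_weight z * w z \<partial>phase_measure)"
proof (rule integral_pos_if_not_AE_zero[OF assms(1)])
  show "AE z in phase_measure. 0 \<le> flux_weight z * w z"
    using flux_weight_nonneg w by (intro AE_I2 mult_nonneg_nonneg) (auto intro: less_imp_le)
  show "\<not> (AE z in phase_measure. flux_weight z * w z = 0)"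
  proof
    assume "AE z in phase_measure. flux_weight z * w z = 0"
    then have "AE z in phase_measure. f z = 0"
    proof (rule AE_mp, intro AE_I2 impI)
      fix z assume z: "z \<in> space phase_measure" and "flux_weight z * w z = 0"
      then have "flux_weight z = 0" using w[OF z] by simp
      then show "f z = 0"
        using z e_pos[of "fst z"] by (auto simp: flux_weight_def state_density_def space_phase_measure)
    qed
    then show False using f_nonzero by simp
  qed
qed

text \<open>
  The flux averages the four-momenta, which are strictly timelike, with a weight that is not almost everywhere zero.
\<close>

lemma flux_timelike: "norm (snd (flux m c \<sigma> f)) < fst (flux m c \<sigma> f)"
proof -
  have int: "integrable phase_measure (\<lambda>z. flux_weight z * norm (fst z))"
    using energy0_ge_norm by (intro integrable_flux_weight_bounded[where C=1]) auto
  have time: "integrable phase_measure (\<lambda>z. flux_weight z * energy0 m c (fst z))"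
    using has_time_flux by (simp add: has_bochner_integral_iff)
  have "norm (snd (flux m c \<sigma> f)) = norm (\<integral>z. flux_weight z *\<^sub>R fst z \<partial>phase_measure)"
    using has_space_flux by (simp add: has_bochner_integral_iff)
  also have "\<dots> \<le> (\<integral>z. norm (flux_weight z *\<^sub>R fst z) \<partial>phase_measure)" by (rule integral_norm_bound)
  also have "\<dots> = (\<integral>z. flux_weight z * norm (fst z) \<partial>phase_measure)"
    using flux_weight_nonneg by (intro Bochner_Integration.integral_cong) auto
  also have "\<dots> < (\<integral>z. flux_weight z * energy0 m c (fst z) \<partial>phase_measure)"
  proof -
    have "0 < (\<integral>z. flux_weight z * (energy0 m c (fst z) - norm (fst z)) \<partial>phase_measure)"
    proof (rule integral_flux_weight_pos)
      show "integrable phase_measure (\<lambda>z. flux_weight z * (energy0 m c (fst z) - norm (fst z)))"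
        using time int by (simp add: right_diff_distrib)
      show "0 < energy0 m c (fst z) - norm (fst z)" for z :: "(real ^ 3) \<times> real"
        using m c by (simp add: energy0_def real_less_rsqrt)
    qed
    then show ?thesis using time int by (simp add: right_diff_distrib)
  qed
  also have "\<dots> = fst (flux m c \<sigma> f)" using has_time_flux by (simp add: has_bochner_integral_iff)
  finally show ?thesis .
qed

lemma eckart_n_flux: "eckart_n m c \<sigma> f = sqrt ((fst (flux m c \<sigma> f))\<^sup>2 - (norm (snd (flux m c \<sigma> f)))\<^sup>2)"
proof -
  have "(\<lambda>(p, I). f (p, I) * state_density \<sigma> I) = (\<lambda>z. flux_weight z * energy0 m c (fst z))"
    using e_pos by (auto simp: flux_weight_def fun_eq_iff less_imp_neq[symmetric])
  then have t: "integral\<^sup>L phase_measure (\<lambda>(p, I). f (p, I) * state_density \<sigma> I) = fst (flux m c \<sigma> f)"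
    using has_time_flux by (simp add: has_bochner_integral_iff)
  have s: "integral\<^sup>L phase_measure (\<lambda>(p, I). p $ i * f (p, I) * state_density \<sigma> I / energy0 m c p)
      = snd (flux m c \<sigma> f) $ i" for i
    using has_bochner_integral_bounded_linear[OF bounded_linear_vec_nth[of i] has_space_flux]
    by (simp add: has_bochner_integral_iff flux_weight_def case_prod_beta' mult_ac)
  have "(norm v)\<^sup>2 = (\<Sum>i\<in>UNIV. (v $ i)\<^sup>2)" for v :: "real ^ 3"
    unfolding power2_norm_eq_inner inner_vec_def by (simp add: power2_eq_square)
  then show ?thesis unfolding eckart_n_def t s by simp
qed

lemma eckart_n_pos: "0 < eckart_n m c \<sigma> f"
  unfolding eckart_n_flux using flux_timelike by (simp add: power_strict_mono)

text \<open>
  The spatial part of the Eckart four-velocity in units of \<open>c\<close>.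
\<close>

definition mean_velocity :: "real ^ 3" where
  "mean_velocity = snd (flux m c \<sigma> f) /\<^sub>R eckart_n m c \<sigma> f"

lemma flux_eq: "flux m c \<sigma> f = eckart_n m c \<sigma> f *\<^sub>R (lorentz_factor mean_velocity, mean_velocity)"
proof -
  let ?n = "eckart_n m c \<sigma> f"
  have n2: "?n\<^sup>2 = (fst (flux m c \<sigma> f))\<^sup>2 - (norm (snd (flux m c \<sigma> f)))\<^sup>2"
    unfolding eckart_n_flux using flux_timelike by (simp add: power_mono)
  have "?n * lorentz_factor mean_velocity = sqrt (?n\<^sup>2 * (1 + (norm mean_velocity)\<^sup>2))"
    using eckart_n_pos by (simp add: lorentz_factor_def real_sqrt_mult)
  also have "?n\<^sup>2 * (1 + (norm mean_velocity)\<^sup>2) = ?n\<^sup>2 + (norm (snd (flux m c \<sigma> f)))\<^sup>2"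
    using eckart_n_pos by (simp add: mean_velocity_def field_simps)
  also have "\<dots> = (fst (flux m c \<sigma> f))\<^sup>2" by (simp add: n2)
  finally have "?n * lorentz_factor mean_velocity = fst (flux m c \<sigma> f)"
    using flux_timelike norm_ge_zero[of "snd (flux m c \<sigma> f)"] by simp
  then show ?thesis using eckart_n_pos by (simp add: prod_eq_iff mean_velocity_def)
qed

text \<open>
  A timelike four-vector is a positive multiple of exactly one normalized four-velocity: the factor is its Minkowski
  length, and the spatial part fixes the velocity.
\<close>

lemma flux_eq_iff:
  assumes "0 < n"
  shows "(n / c) *\<^sub>R four_velocity c U = flux m c \<sigma> f \<longleftrightarrow> n = eckart_n m c \<sigma> f \<and> U = c *\<^sub>R mean_velocity"
proof
  assume "n = eckart_n m c \<sigma> f \<and> U = c *\<^sub>R mean_velocity"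
  then show "(n / c) *\<^sub>R four_velocity c U = flux m c \<sigma> f"
    using c by (simp add: four_velocity_eq flux_eq)
next
  assume "(n / c) *\<^sub>R four_velocity c U = flux m c \<sigma> f"
  moreover have "(n / c) *\<^sub>R four_velocity c U = n *\<^sub>R (lorentz_factor (U /\<^sub>R c), U /\<^sub>R c)"
    using c by (simp add: four_velocity_eq divide_inverse)
  ultimately have eq: "flux m c \<sigma> f = n *\<^sub>R (lorentz_factor (U /\<^sub>R c), U /\<^sub>R c)" by simp
  have "(fst (flux m c \<sigma> f))\<^sup>2 - (norm (snd (flux m c \<sigma> f)))\<^sup>2 = n\<^sup>2"
    unfolding eq using c by (simp add: power_mult_distrib lorentz_factor_def algebra_simps)
  then have n: "n = eckart_n m c \<sigma> f" using assms by (simp add: eckart_n_flux)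
  have "mean_velocity = U /\<^sub>R c" using assms by (simp add: mean_velocity_def eq flip: n)
  then show "n = eckart_n m c \<sigma> f \<and> U = c *\<^sub>R mean_velocity" using n c by simp
qed

lemma has_inverse_energy_moment:
  "has_bochner_integral phase_measure (\<lambda>z. flux_weight z * inverse (1 + snd z / (m * c\<^sup>2)))
     (inverse_energy_moment m c \<sigma> f)"
proof -
  have "integrable phase_measure (\<lambda>z. flux_weight z * inverse (1 + snd z / (m * c\<^sup>2)))"
  proof (rule integrable_flux_weight_bounded)
    fix z :: "(real ^ 3) \<times> real" assume "z \<in> space phase_measure"
    then have "1 \<le> 1 + snd z / (m * c\<^sup>2)" using m c by (auto simp: space_phase_measure)
    then have "\<bar>inverse (1 + snd z / (m * c\<^sup>2))\<bar> \<le> 1" by (simp add: inverse_le_1_iff)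
    also have "1 \<le> energy0 m c (fst z) * inverse (m * c)"
      using energy0_ge_mass[of m c "fst z"] m c by (simp add: field_simps)
    finally show "\<bar>inverse (1 + snd z / (m * c\<^sup>2))\<bar> \<le> energy0 m c (fst z) * inverse (m * c)" .
  qed measurable
  then show ?thesis
    by (simp add: has_bochner_integral_iff inverse_energy_moment_def flux_weight_def case_prod_beta' mult_ac)
qed

text \<open>
  Contracting the flux with its own velocity exhibits \<open>n\<^sub>f\<close> as the integral of the weight times the comoving energy
  \<open>lorentz_factor u * p\<^sup>0 - inner u p\<close>, where \<open>u\<close> is the mean velocity. This energy is at least \<open>m * c\<close>, because it is the
  energy of a boosted momentum, whereas the moment carries the factor \<open>1 / (1 + I / (m c\<^sup>2)) < 1\<close>. This is the
  inequality that puts the prescribed value of \<open>juttner_M_tilde / juttner_M\<close> into its range.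
\<close>

lemma inverse_energy_moment_bounds:
  shows "0 < inverse_energy_moment m c \<sigma> f"
    and "m * c * inverse_energy_moment m c \<sigma> f < eckart_n m c \<sigma> f"
proof -
  let ?s = "\<lambda>z :: (real ^ 3) \<times> real. inverse (1 + snd z / (m * c\<^sup>2))"
  let ?v = "\<lambda>z :: (real ^ 3) \<times> real. lorentz_factor mean_velocity * energy0 m c (fst z) - inner mean_velocity (fst z)"
  have s: "0 < ?s z" "?s z < 1" if "z \<in> space phase_measure" for z
  proof -
    have "0 < snd z / (m * c\<^sup>2)" using that m c by (auto simp: space_phase_measure)
    then show "0 < ?s z" "?s z < 1" by (auto simp: inverse_less_1_iff)
  qed
  have A: "integrable phase_measure (\<lambda>z. flux_weight z * ?s z)"
    "(\<integral>z. flux_weight z * ?s z \<partial>phase_measure) = inverse_energy_moment m c \<sigma> f"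
    using has_inverse_energy_moment by (simp_all add: has_bochner_integral_iff)
  show "0 < inverse_energy_moment m c \<sigma> f"
    using integral_flux_weight_pos[OF A(1) s(1)] A(2) by simp
  have "has_bochner_integral phase_measure
      (\<lambda>z. lorentz_factor mean_velocity * (flux_weight z * energy0 m c (fst z)) - inner mean_velocity (flux_weight z *\<^sub>R fst z))
      (lorentz_factor mean_velocity * fst (flux m c \<sigma> f) - inner mean_velocity (snd (flux m c \<sigma> f)))"
    by (intro has_bochner_integral_diff has_bochner_integral_mult_right has_time_flux
        has_bochner_integral_inner_right has_space_flux)
  also have "(\<lambda>z. lorentz_factor mean_velocity * (flux_weight z * energy0 m c (fst z)) - inner mean_velocity (flux_weight z *\<^sub>R fst z)) = (\<lambda>z. flux_weight z * ?v z)"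
    by (simp add: fun_eq_iff algebra_simps)
  also have "lorentz_factor mean_velocity * fst (flux m c \<sigma> f) - inner mean_velocity (snd (flux m c \<sigma> f))
      = eckart_n m c \<sigma> f * ((lorentz_factor mean_velocity)\<^sup>2 - inner mean_velocity mean_velocity)"
    by (subst (1 2) flux_eq) (simp add: algebra_simps power2_eq_square)
  also have "\<dots> = eckart_n m c \<sigma> f"
    by (simp add: norm_sq_conv_lorentz_factor power2_eq_square algebra_simps)
  finally have B: "integrable phase_measure (\<lambda>z. flux_weight z * ?v z)"
    "(\<integral>z. flux_weight z * ?v z \<partial>phase_measure) = eckart_n m c \<sigma> f"
    by (simp_all add: has_bochner_integral_iff)
  have "0 < (\<integral>z. flux_weight z * (?v z - m * c * ?s z) \<partial>phase_measure)"
  proof (rule integral_flux_weight_pos)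
    show "integrable phase_measure (\<lambda>z. flux_weight z * (?v z - m * c * ?s z))"
      using Bochner_Integration.integrable_diff[OF B(1) integrable_mult_right[OF A(1), of "m * c"]]
      by (simp add: algebra_simps)
    fix z :: "(real ^ 3) \<times> real" assume z: "z \<in> space phase_measure"
    have "m * c * ?s z < m * c * 1" using s[OF z] m c by (intro mult_strict_left_mono) auto
    also have "\<dots> \<le> energy0 m c (boost m c mean_velocity (fst z))" using energy0_ge_mass by simp
    also have "\<dots> = ?v z" using m c by (simp add: energy0_boost)
    finally show "0 < ?v z - m * c * ?s z" by simp
  qed
  also have "(\<integral>z. flux_weight z * (?v z - m * c * ?s z) \<partial>phase_measure)
      = (\<integral>z. flux_weight z * ?v z - m * c * (flux_weight z * ?s z) \<partial>phase_measure)"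
    by (intro Bochner_Integration.integral_cong) (auto simp: algebra_simps)
  also have "\<dots> = eckart_n m c \<sigma> f - m * c * inverse_energy_moment m c \<sigma> f"
    using A B by simp
  finally show "m * c * inverse_energy_moment m c \<sigma> f < eckart_n m c \<sigma> f" by simp
qed

text \<open>
  In the laws for energy and momentum the factor \<open>m c\<^sup>2 + I\<close> cancels the factor \<open>1 + I / (m c\<^sup>2)\<close> of the relaxation time,
  which leaves the flux. In the law for the particle number this factor stays and leaves the moment of
  \<open>1 / ((1 + I / (m c\<^sup>2)) p\<^sup>0)\<close>.
\<close>

lemma equilibrium_parameters_iff_moments:
  assumes \<tau>: "0 < \<tau>"
  shows "equilibrium_parameters m c \<tau> \<sigma> f n U \<gamma> \<longleftrightarrow> 0 < n \<and> 0 < \<gamma> \<and>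
    n * (juttner_M_tilde m c \<sigma> \<gamma> / juttner_M m c \<sigma> \<gamma>) = inverse_energy_moment m c \<sigma> f \<and>
    (n / c) *\<^sub>R four_velocity c U = flux m c \<sigma> f"
proof (cases "0 < n \<and> 0 < \<gamma>")
  case True
  define J where "J = juttner m c \<sigma> n (four_velocity c U) \<gamma>"
  let ?R = "n * (juttner_M_tilde m c \<sigma> \<gamma> / juttner_M m c \<sigma> \<gamma>)"
  let ?Q = "collision_op m c \<tau> J f"
  let ?k = "c * m / \<tau>"
  have "has_bochner_integral phase_measure (\<lambda>z. ?k *
      ((case z of (p, I) \<Rightarrow> J (p, I) * inverse (1 + I / (m * c\<^sup>2)) * state_density \<sigma> I / energy0 m c p)
        - flux_weight z * inverse (1 + snd z / (m * c\<^sup>2)))) (?k * (?R - inverse_energy_moment m c \<sigma> f))"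
    unfolding J_def using True
    by (intro has_bochner_integral_mult_right has_bochner_integral_diff has_inverse_energy_moment
        has_bochner_integral_inverse_juttner m c \<sigma>) simp
  also have "(\<lambda>z. ?k *
      ((case z of (p, I) \<Rightarrow> J (p, I) * inverse (1 + I / (m * c\<^sup>2)) * state_density \<sigma> I / energy0 m c p)
        - flux_weight z * inverse (1 + snd z / (m * c\<^sup>2)))) = (\<lambda>(p, I). ?Q (p, I) * state_density \<sigma> I)"
  proof -
    have "?k * (j * inverse s * d / e - g * d / e * inverse s) = c * m / (\<tau> * s * e) * (j - g) * d"
      for s e d j g :: real
      by (simp add: divide_inverse algebra_simps)
    then show ?thesis by (simp add: fun_eq_iff collision_op_def flux_weight_def)
  qed
  finally have 1: "has_bochner_integral phase_measure (\<lambda>(p, I). ?Q (p, I) * state_density \<sigma> I)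
      (?k * (?R - inverse_energy_moment m c \<sigma> f))" .
  have "has_bochner_integral phase_measure
      (\<lambda>z. (?k * (m * c\<^sup>2)) *\<^sub>R (flux_density m c \<sigma> J z - flux_density m c \<sigma> f z))
      ((?k * (m * c\<^sup>2)) *\<^sub>R ((n / c) *\<^sub>R four_velocity c U - flux m c \<sigma> f))"
    unfolding J_def using True has_flux
    by (intro has_bochner_integral_scaleR_right has_bochner_integral_diff
        has_bochner_integral_flux_juttner m c \<sigma>) (auto simp: flux_density_flux_weight)
  also have "?this \<longleftrightarrow> has_bochner_integral phase_measure (\<lambda>(p, I).
       ((m * c\<^sup>2 + I) * ?Q (p, I) * state_density \<sigma> I) *\<^sub>R four_momentum m c p)
      ((?k * (m * c\<^sup>2)) *\<^sub>R ((n / c) *\<^sub>R four_velocity c U - flux m c \<sigma> f))"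
  proof (rule has_bochner_integral_cong)
    fix z assume "z \<in> space phase_measure"
    then obtain p I where z: "z = (p, I)" "0 < I" by (auto simp: space_phase_measure)
    have "0 < 1 + I / (m * c\<^sup>2)" using z m c by (simp add: add_pos_pos)
    moreover have "(K * s) * (c * m / (\<tau> * s * e) * x) * d = ?k * K * (x * d / e)"
      if "s \<noteq> 0" for K s e x d :: real
      using that by simp
    moreover have "m * c\<^sup>2 + I = m * c\<^sup>2 * (1 + I / (m * c\<^sup>2))" using m c by (simp add: field_simps)
    ultimately have "(m * c\<^sup>2 + I) * ?Q (p, I) * state_density \<sigma> I
        = ?k * (m * c\<^sup>2) * ((J (p, I) - f (p, I)) * state_density \<sigma> I / energy0 m c p)"
      by (simp only: collision_op_def prod.case)
    then show "(?k * (m * c\<^sup>2)) *\<^sub>R (flux_density m c \<sigma> J z - flux_density m c \<sigma> f z)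
        = (case z of (p, I) \<Rightarrow> ((m * c\<^sup>2 + I) * ?Q (p, I) * state_density \<sigma> I) *\<^sub>R four_momentum m c p)"
      by (simp add: z flux_density_def left_diff_distrib diff_divide_distrib flip: scaleR_diff_left)
  qed auto
  finally have 2: "has_bochner_integral phase_measure (\<lambda>(p, I).
       ((m * c\<^sup>2 + I) * ?Q (p, I) * state_density \<sigma> I) *\<^sub>R four_momentum m c p)
      ((?k * (m * c\<^sup>2)) *\<^sub>R ((n / c) *\<^sub>R four_velocity c U - flux m c \<sigma> f))" .
  have k: "?k \<noteq> 0" "?k * (m * c\<^sup>2) \<noteq> 0" using m c \<tau> by auto
  show ?thesis
    unfolding equilibrium_parameters_def conservation_laws_def J_def[symmetric]
      has_bochner_integral_iff_eq[OF 1] has_bochner_integral_iff_eq[OF 2]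
    using True k by auto
qed (auto simp: equilibrium_parameters_def)

lemma gamma_relation_iff:
  "gamma_relation m c \<sigma> f \<gamma> \<longleftrightarrow>
    juttner_M_tilde m c \<sigma> \<gamma> / juttner_M m c \<sigma> \<gamma> = inverse_energy_moment m c \<sigma> f / eckart_n m c \<sigma> f"
  by (simp add: gamma_relation_def inverse_energy_moment_def)

lemma equilibrium_parameters_iff:
  assumes "0 < \<tau>"
  shows "equilibrium_parameters m c \<tau> \<sigma> f n U \<gamma> \<longleftrightarrow>
    n = eckart_n m c \<sigma> f \<and> U = c *\<^sub>R mean_velocity \<and> 0 < \<gamma> \<and> gamma_relation m c \<sigma> f \<gamma>"
proof -
  let ?y = "juttner_M_tilde m c \<sigma> \<gamma> / juttner_M m c \<sigma> \<gamma>"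
  have "eckart_n m c \<sigma> f * ?y = inverse_energy_moment m c \<sigma> f
      \<longleftrightarrow> ?y = inverse_energy_moment m c \<sigma> f / eckart_n m c \<sigma> f"
    using eckart_n_pos by (metis less_irrefl nonzero_mult_div_cancel_left nonzero_eq_divide_eq mult.commute)
  then show ?thesis
    unfolding equilibrium_parameters_iff_moments[OF assms] gamma_relation_iff
    using eckart_n_pos flux_eq_iff[of n U] by blast
qed

lemma gamma_unique: "\<exists>!\<gamma>. 0 < \<gamma> \<and> gamma_relation m c \<sigma> f \<gamma>"
  unfolding gamma_relation_iff
proof (rule juttner_M_tilde_ratio_unique_root)
  show "0 < inverse_energy_moment m c \<sigma> f / eckart_n m c \<sigma> f"
    using inverse_energy_moment_bounds eckart_n_pos by simp
  show "inverse_energy_moment m c \<sigma> f / eckart_n m c \<sigma> f < inverse (m * c)"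
    using inverse_energy_moment_bounds eckart_n_pos m c by (simp add: field_simps)
qed (use m c \<sigma> in auto)

lemma four_velocity_eckart: "four_velocity c (c *\<^sub>R mean_velocity) = eckart_U m c \<sigma> f"
  using c eckart_n_pos
  by (simp add: eckart_U_def flux_def[symmetric] four_velocity_eq flux_eq)

end

section \<open>Existence and uniqueness of the equilibrium\<close>

theorem theorem1p1:
  fixes m c \<tau> \<sigma> :: real and f :: "(real ^ 3) \<times> real \<Rightarrow> real"
  assumes "m > 0" and "c > 0" and "\<tau> > 0" and "\<sigma> > -1"
    and "f \<in> borel_measurable phase_measure"
    and "\<And>p I. I > 0 \<Longrightarrow> f (p, I) \<ge> 0"
    and "\<not> (AE z in phase_measure. f z = 0)"
    and "integrable phase_measure (flux_density m c \<sigma> f)"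
  shows "(\<exists>!(n, U, \<gamma>). equilibrium_parameters m c \<tau> \<sigma> f n U \<gamma>) \<and>
         (\<forall>n U \<gamma>. equilibrium_parameters m c \<tau> \<sigma> f n U \<gamma> \<longrightarrow>
            n = eckart_n m c \<sigma> f \<and> four_velocity c U = eckart_U m c \<sigma> f \<and>
            gamma_relation m c \<sigma> f \<gamma>) \<and>
         (\<exists>!\<gamma>. \<gamma> > 0 \<and> gamma_relation m c \<sigma> f \<gamma>)"
proof -
  interpret distribution_function m c \<sigma> f by unfold_locales fact+
  note iff = equilibrium_parameters_iff[OF assms(3)]
  obtain \<gamma> where \<gamma>: "0 < \<gamma>" "gamma_relation m c \<sigma> f \<gamma>"
    and uniq: "\<And>\<gamma>'. 0 < \<gamma>' \<and> gamma_relation m c \<sigma> f \<gamma>' \<Longrightarrow> \<gamma>' = \<gamma>"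
    using gamma_unique by blast
  have "\<exists>!(n, U, \<gamma>). equilibrium_parameters m c \<tau> \<sigma> f n U \<gamma>"
  proof (rule ex1I[of _ "(eckart_n m c \<sigma> f, c *\<^sub>R mean_velocity, \<gamma>)"])
    fix z :: "real \<times> (real ^ 3) \<times> real"
    assume "case z of (n, U, \<gamma>) \<Rightarrow> equilibrium_parameters m c \<tau> \<sigma> f n U \<gamma>"
    then show "z = (eckart_n m c \<sigma> f, c *\<^sub>R mean_velocity, \<gamma>)"
      by (cases z) (use uniq in \<open>simp add: iff\<close>)
  qed (use \<gamma> in \<open>simp add: iff\<close>)
  moreover have "\<forall>n U \<gamma>. equilibrium_parameters m c \<tau> \<sigma> f n U \<gamma> \<longrightarrow>
      n = eckart_n m c \<sigma> f \<and> four_velocity c U = eckart_U m c \<sigma> f \<and> gamma_relation m c \<sigma> f \<gamma>"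
    using four_velocity_eckart by (simp add: iff)
  ultimately show ?thesis using gamma_unique by blast
qed

end
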